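(* Let $p<q$ and let $e=e_1e_2\ldots e_l$ be the descent of the skew basic $(p,q)$-leaper $L$. Consider all suffixes $e_{j+1}e_{j+2}\ldots e_l$ of $e$ such that $e_j$ is either $\mathtt g$ or $\mathtt h$, listed in order of increasing $j$. Let $k$ be one larger than the number of such suffixes, let the $i$-th such suffix, $i=1,2,\ldots,k-1$, be the descent of a $(p_i,q_i)$-leaper, and let $p_k=0$ and $q_k=1$. Then the leaper graph $G$ of $L$ over a $(p+q)\times(p+q)$ chessboard consists of $(q-p)^2$ isolated vertices and a number of disjoint cycles of $k$ distinct types. For all $i=1,\ldots,k$, $G$ contains $(q_i-p_i)^2$ cycles of type $i$, all of which are translation copies of each other and each of which is also toured by a $(p_i,q_i)$-leaper.
   Context: A square is a unit square of the infinite chessboard; a board is a set of squares. For nonnegative integers $p,q$, not both zero, a $(p,q)$-leaper is a piece that moves from a square $a$ to any of $a+(\pm p,\pm q)$, $a+(\pm q,\pm p)$; a $(p,q)$-leaper and a $(q,p)$-leaper are the same leaper. The leaper graph of $L$ over a board $B$ has the squares of $B$ as vertices, two squares being adjacent when a move of $L$ joins them. A cycle is "toured" by a leaper $M$ if the leaper graph of $M$ over the set of squares visited by the cycle contains a Hamiltonian cycle. A $(p,q)$-leaper is basic if $p+q$ is odd and $\gcd(p,q)=1$, and skew if $p\ne0$, $q\neq 0$, $p\ne q$. Descent. Define three operations on pairs of integers $(m,n)$, $0<m<n$: type $\mathtt f$ sends $(m,n)$ to $(m,2m+n)$; type $\mathtt g$ sends $(m,n)$ to $(n,2n-m)$; type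 $\mathtt h$ sends $(m,n)$ to $(n,m+2n)$. For a skew basic $(p,q)$-leaper, $p<q$, its descent is the unique (possibly empty) string $e_1e_2\ldots e_l$ of characters $\mathtt f,\mathtt g,\mathtt h$ such that successively applying the operations of types $e_l,e_{l-1},\ldots,e_1$ to $(1,2)$ yields $(p,q)$. Every string of characters $\mathtt f,\mathtt g,\mathtt h$ is the descent of exactly one skew basic leaper. "Cycles of $k$ distinct types" means that the cycles of $G$ are divided into $k$ pairwise disjoint classes, called type $1$, ..., type $k$. *)

theory Defs
  imports Complex_Main "HOL-Library.Product_Plus" "HOL-Library.Disjoint_Sets"
begin

datatype 'a ugraph = UGraph (verts: "'a set") (edges: "'a set set")

definition subgraph_of :: "'a ugraph \<Rightarrow> 'a ugraph \<Rightarrow> bool" where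
  "subgraph_of H G \<longleftrightarrow> verts H \<subseteq> verts G \<and> edges H \<subseteq> edges G"

definition isolated :: "'a ugraph \<Rightarrow> 'a \<Rightarrow> bool" where
  "isolated G v \<longleftrightarrow> v \<in> verts G \<and> (\<forall>e\<in>edges G. v \<notin> e)"

definition cycle_through :: "'a list \<Rightarrow> 'a ugraph" where
  "cycle_through vs =
     UGraph (set vs) {{vs ! i, vs ! (Suc i mod length vs)} | i. i < length vs}"

definition is_cycle :: "'a ugraph \<Rightarrow> bool" where
  "is_cycle H \<longleftrightarrow> (\<exists>vs. distinct vs \<and> 3 \<le> length vs \<and> H = cycle_through vs)"

text \<open>Cycles are subgraphs rather than vertex lists, so that a cycle has no distinguished
  starting point or orientation and counting cycles is meaningful.\<close>

definition cycles_of :: "'a ugraph \<Rightarrow> 'a ugraph set" where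
  "cycles_of G = {H. is_cycle H \<and> subgraph_of H G}"

definition hamiltonian :: "'a ugraph \<Rightarrow> bool" where
  "hamiltonian G \<longleftrightarrow> (\<exists>H\<in>cycles_of G. verts H = verts G)"

type_synonym square = "int \<times> int"

definition leaper_move :: "nat \<Rightarrow> nat \<Rightarrow> square \<Rightarrow> square \<Rightarrow> bool" where
  "leaper_move p q a b \<longleftrightarrow>
     (\<exists>s\<in>{1, -1}. \<exists>t\<in>{1, -1}.
        b = a + (s * int p, t * int q) \<or> b = a + (s * int q, t * int p))"

definition leaper_graph :: "nat \<Rightarrow> nat \<Rightarrow> square set \<Rightarrow> square ugraph" where
  "leaper_graph p q B =
     UGraph B {{a, b} | a b. a \<in> B \<and> b \<in> B \<and> leaper_move p q a b}"

definition square_board :: "nat \<Rightarrow> square set" where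
  "square_board n = {0..<int n} \<times> {0..<int n}"

definition translate :: "square \<Rightarrow> square ugraph \<Rightarrow> square ugraph" where
  "translate v H = UGraph ((+) v ` verts H) ((`) ((+) v) ` edges H)"

definition toured_by :: "nat \<Rightarrow> nat \<Rightarrow> square ugraph \<Rightarrow> bool" where
  "toured_by p q H \<longleftrightarrow> hamiltonian (leaper_graph p q (verts H))"

definition basic :: "nat \<Rightarrow> nat \<Rightarrow> bool" where
  "basic p q \<longleftrightarrow> odd (p + q) \<and> coprime p q"

definition skew :: "nat \<Rightarrow> nat \<Rightarrow> bool" where
  "skew p q \<longleftrightarrow> p \<noteq> 0 \<and> q \<noteq> 0 \<and> p \<noteq> q"

datatype op_type = F | G | H

text \<open>The subtraction on naturals is harmless: the operations are applied only to
  pairs with \<open>0 < m < n\<close>, a condition that they preserve.\<close>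

fun apply_op :: "op_type \<Rightarrow> nat \<times> nat \<Rightarrow> nat \<times> nat" where
  "apply_op F (m, n) = (m, 2 * m + n)"
| "apply_op G (m, n) = (n, 2 * n - m)"
| "apply_op H (m, n) = (n, m + 2 * n)"

text \<open>\<open>foldr\<close> applies the operation of the last character first.\<close>

definition is_descent :: "op_type list \<Rightarrow> nat \<Rightarrow> nat \<Rightarrow> bool" where
  "is_descent e p q \<longleftrightarrow> foldr apply_op e (1, 2) = (p, q)"

text \<open>With 1-based indexing of \<open>e\<close>, the suffixes starting right after position \<open>j\<close>,
  for those \<open>j\<close> at which \<open>e\<close> has \<open>G\<close> or \<open>H\<close>; here \<open>e ! (j - 1)\<close> is the
  \<open>j\<close>-th character.\<close>

definition gh_suffixes :: "op_type list \<Rightarrow> op_type list list" where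
  "gh_suffixes e =
     map (\<lambda>j. drop j e) (filter (\<lambda>j. e ! (j - 1) \<in> {G, H}) [1..<Suc (length e)])"

text \<open>The descent of a skew basic leaper exists and is unique, and every string is the
  descent of exactly one such leaper.\<close>

lemma basic_apply_op:
  assumes "0 < m" "m < n" "basic m n" "apply_op c (m, n) = (p, q)"
  shows "0 < p \<and> p < q \<and> basic p q"
proof (cases c)
  case F
  have "gcd m (2 * m + n) = gcd m n"
    by (metis gcd_add_mult mult.commute add.commute)
  then show ?thesis using F assms by (auto simp: basic_def coprime_iff_gcd_eq_1)
next
  case G
  have "coprime n (2 * n - m)"
  proof (rule coprimeI)
    fix d assume d: "d dvd n" "d dvd 2 * n - m"
    then have "d dvd 2 * n - (2 * n - m)" by (meson dvd_diff_nat dvd_mult)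
    then have "d dvd m" using assms by simp
    then show "d dvd 1" using d assms(3) by (auto simp: basic_def coprime_def)
  qed
  then show ?thesis using G assms by (auto simp: basic_def)
next
  case H
  have "coprime n (m + 2 * n)"
  proof (rule coprimeI)
    fix d assume d: "d dvd n" "d dvd m + 2 * n"
    then have "d dvd m" by (metis dvd_add_left_iff dvd_mult)
    then show "d dvd 1" using d assms(3) by (auto simp: basic_def coprime_def)
  qed
  then show ?thesis using H assms by (auto simp: basic_def)
qed

lemma is_descent_basic:
  assumes "is_descent e p q" shows "0 < p \<and> p < q \<and> basic p q"
  using assms
proof (induction e arbitrary: p q)
  case Nil
  then show ?case by (auto simp: is_descent_def basic_def)
next
  case (Cons c e)
  obtain m n where mn: "foldr apply_op e (1, 2) = (m, n)" by fastforce
  then have "0 < m \<and> m < n \<and> basic m n" using Cons.IH by (simp add: is_descent_def)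
  then show ?case
    using basic_apply_op[of m n c p q] Cons.prems mn by (simp add: is_descent_def)
qed

lemma ex1_leaper_of_string:
  "\<exists>!(p, q). p < q \<and> skew p q \<and> basic p q \<and> is_descent e p q"
proof -
  obtain p q where pq: "foldr apply_op e (1, 2) = (p, q)" by fastforce
  then have "0 < p \<and> p < q \<and> basic p q"
    using is_descent_basic by (simp add: is_descent_def)
  with pq show ?thesis by (auto simp: is_descent_def skew_def)
qed

lemma ex_descent:
  assumes "0 < p" "p < q" "basic p q"
  shows "\<exists>e. is_descent e p q"
  using assms
proof (induction "q" arbitrary: p rule: less_induct)
  case (less q)
  note cop = less.prems(3)[unfolded basic_def]
  have step: "\<exists>e. is_descent e p q"
    if mn: "apply_op c (m, n) = (p, q)" "0 < m" "m < n" "n < q" "odd (m + n)"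
       "\<And>d. d dvd m \<Longrightarrow> d dvd n \<Longrightarrow> d dvd p \<and> d dvd q" for c m n
  proof -
    have "coprime m n" using mn(6) cop by (meson coprime_def)
    then obtain e where "is_descent e m n"
      using less.IH[of n m] mn by (auto simp: basic_def)
    then have "is_descent (c # e) p q" using mn by (simp add: is_descent_def)
    then show ?thesis ..
  qed
  consider "q < 2 * p" | "q = 2 * p" | "2 * p < q" "q < 3 * p" | "q = 3 * p" | "3 * p < q"
    by linarith
  then show ?case
  proof cases
    case 1
    show ?thesis
    proof (rule step[of G "2 * p - q" p])
      fix d assume d: "d dvd 2 * p - q" "d dvd p"
      then have "d dvd 2 * p - (2 * p - q)" by (meson dvd_diff_nat dvd_mult)
      then show "d dvd p \<and> d dvd q" using d 1 by simp
    qed (use 1 less.prems cop in auto)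
  next
    case 2
    then have "is_descent [] p q" using cop by (simp add: is_descent_def)
    then show ?thesis ..
  next
    case 3
    show ?thesis
    proof (rule step[of H "q - 2 * p" p])
      fix d assume d: "d dvd q - 2 * p" "d dvd p"
      then have "d dvd (q - 2 * p) + 2 * p" by (meson dvd_add dvd_mult)
      then show "d dvd p \<and> d dvd q" using d 3 by simp
    qed (use 3 less.prems cop in auto)
  next
    case 4
    then show ?thesis using cop by simp
  next
    case 5
    show ?thesis
    proof (rule step[of F p "q - 2 * p"])
      fix d assume d: "d dvd p" "d dvd q - 2 * p"
      then have "d dvd (q - 2 * p) + 2 * p" by (meson dvd_add dvd_mult)
      then show "d dvd p \<and> d dvd q" using d 5 by simp
    qed (use 5 less.prems cop in auto)
  qed
qed

lemma apply_op_eq: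
  assumes "apply_op c x = apply_op c' x'" "0 < fst x" "fst x < snd x" "0 < fst x'" "fst x' < snd x'"
  shows "c = c' \<and> x = x'"
  using assms by (cases c; cases c'; cases x; cases x') auto

lemma descent_unique:
  assumes "foldr apply_op e (1, 2) = foldr apply_op e' (1, 2)"
  shows "e = e'"
proof -
  have pos: "0 < fst (foldr apply_op u (1, 2)) \<and>
      fst (foldr apply_op u (1, 2)) < snd (foldr apply_op u (1, 2))" for u
    using is_descent_basic[of u] by (cases "foldr apply_op u (1, 2)") (auto simp: is_descent_def)
  have ne: "apply_op c (foldr apply_op u (1, 2)) \<noteq> (1, 2)" for c u
    using pos[of u] by (cases c; cases "foldr apply_op u (1, 2)") auto
  show ?thesis
    using assms
  proof (induction e arbitrary: e')
    case Nil
    then show ?case using ne by (cases e') (auto simp del: apply_op.simps, metis)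
  next
    case (Cons c u)
    show ?case
    proof (cases e')
      case Nil
      then show ?thesis using Cons.prems ne by simp
    next
      case (Cons c' u')
      then have "c = c' \<and> foldr apply_op u (1, 2) = foldr apply_op u' (1, 2)"
        using apply_op_eq Cons.prems pos by simp
      then show ?thesis using Cons Cons.IH by blast
    qed
  qed
qed

lemma ex1_descent:
  assumes "p < q" "skew p q" "basic p q"
  shows "\<exists>!e. is_descent e p q"
  using ex_descent[of p q] descent_unique assms by (auto simp: is_descent_def skew_def)

end

theory Submission
  imports Defs
begin

text \<open>
On the board of side $N = p + q$ every square has degree zero (both coordinates in the middle range
$[p, q)$) or two, so the graph is a disjoint union of cycles; the point is to identify them.
Each cycle is a translate of a shape $S$ centred at the origin and invariant under the symmetries of
the square. If $S$ is toured by an $(m, n)$-leaper and $d = n - m$, then $S$ fits into the board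
with a slack of $d$ in both directions, which gives the $d^2$ translation copies.

The shapes for the descent $c e$ arise from those for $e$. Each of the operations $F$, $G$, $H$ lifts
a shape of the old leaper to a shape of the new one, by replacing every square with a few
squares near the borders of the new board. The lift maps closed connected sets to closed connected sets.
Moreover, the $(m, n)$-tour of $S$ splits into four corner arcs and four side arcs, and the arcs of
the lifted shape are reflected or translated concatenations of old arcs; that the pieces fit together is a
linear condition on the squares at which a corner arc meets a side arc, and this condition is
preserved. For $G$ and $H$, the lift of the single square at the origin (an isolated square of the
old board) is a cycle of length eight, toured by the old leaper: this is the new type.

The numbers of corner and side squares transform in such a way that the copies of all shapes have
$4p^2$ corner and $4p(q - p)$ side squares altogether. These are all the squares outside the middle, so there
are no further cycles.
\<close>

section \<open>Graphs of maximum degree two\<close>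

definition induced :: "('a \<Rightarrow> 'a \<Rightarrow> bool) \<Rightarrow> 'a set \<Rightarrow> 'a ugraph" where
  "induced adj K = UGraph K {{a, b} | a b. a \<in> K \<and> b \<in> K \<and> adj a b}"

definition adj_rel :: "('a \<Rightarrow> 'a \<Rightarrow> bool) \<Rightarrow> 'a set \<Rightarrow> 'a rel" where
  "adj_rel adj K = {(a, b). a \<in> K \<and> b \<in> K \<and> adj a b}"

definition connected_in :: "('a \<Rightarrow> 'a \<Rightarrow> bool) \<Rightarrow> 'a set \<Rightarrow> bool" where
  "connected_in adj K \<longleftrightarrow> (\<forall>a\<in>K. \<forall>b\<in>K. (a, b) \<in> (adj_rel adj K)\<^sup>*)"

text \<open>This is how connectedness identifies vertex sets below: if two connected sets meet and
  neither can be left along an edge into the other, each contains the other.\<close>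

lemma connected_in_closed:
  assumes "connected_in adj K" "A \<inter> K \<noteq> {}" "\<And>a b. a \<in> A \<Longrightarrow> b \<in> K \<Longrightarrow> adj a b \<Longrightarrow> b \<in> A"
  shows "K \<subseteq> A"
proof
  fix b assume b: "b \<in> K"
  obtain a where a: "a \<in> A" "a \<in> K" using assms(2) by auto
  have "(a, b) \<in> (adj_rel adj K)\<^sup>*" using a b assms(1) by (auto simp: connected_in_def)
  then show "b \<in> A"
    by (induction rule: rtrancl_induct) (use a assms(3) in \<open>auto simp: adj_rel_def\<close>)
qed

text \<open>With at least three positions, cyclic predecessor and successor differ, so a vertex of a
  cycle has two different neighbours on the cycle.\<close>

lemma pred_index:
  assumes "i < n" "3 \<le> n"
  obtains j where "j < n" "Suc j mod n = i" "j \<noteq> Suc i mod n"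
proof (cases i)
  case 0
  then show ?thesis using that[of "n - 1"] assms by (auto simp: mod_Suc)
next
  case (Suc j)
  then show ?thesis using that[of j] assms by (auto simp: mod_Suc)
qed

text \<open>The cyclic predecessor and successor already account for the two neighbours that the
  degree bound allows, so an edge at a vertex of the cycle can neither leave the cycle nor be a
  chord.\<close>

lemma cycle_degree_closed:
  assumes "distinct vs" "3 \<le> length vs" "set vs \<subseteq> V" "symp adj"
    and adj: "\<And>i. i < length vs \<Longrightarrow> adj (vs ! i) (vs ! (Suc i mod length vs))"
    and deg: "\<And>v. v \<in> V \<Longrightarrow> finite {w \<in> V. adj v w} \<and> card {w \<in> V. adj v w} \<le> 2"
    and i: "i < length vs" and w: "w \<in> V" "adj (vs ! i) w"
  shows "\<exists>j<length vs. {vs ! i, w} = {vs ! j, vs ! (Suc j mod length vs)}"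
proof -
  let ?n = "length vs"
  obtain j where j: "j < ?n" "Suc j mod ?n = i" "j \<noteq> Suc i mod ?n"
    using pred_index[OF i assms(2)] .
  have lt: "Suc i mod ?n < ?n" using i by (intro mod_less_divisor) linarith
  have "{vs ! j, vs ! (Suc i mod ?n)} \<subseteq> {w \<in> V. adj (vs ! i) w}"
    using adj[OF i] adj[OF j(1)] j assms(3,4) lt by (auto dest: sympD)
  moreover have "card {vs ! j, vs ! (Suc i mod ?n)} = 2"
    using j lt assms(1) by (simp add: nth_eq_iff_index_eq card_insert_if)
  moreover have "vs ! i \<in> V" using i assms(3) by auto
  ultimately have "{vs ! j, vs ! (Suc i mod ?n)} = {w \<in> V. adj (vs ! i) w}"
    using deg[of "vs ! i"] by (intro card_seteq) auto
  then have "w = vs ! j \<or> w = vs ! (Suc i mod ?n)" using w by auto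
  then show ?thesis using i j by (metis insert_commute)
qed

lemma cycle_connected:
  assumes adj: "\<And>i. i < length vs \<Longrightarrow> adj (vs ! i) (vs ! (Suc i mod length vs))"
    and "symp adj"
  shows "connected_in adj (set vs)"
proof -
  have fwd: "(vs ! 0, vs ! i) \<in> (adj_rel adj (set vs))\<^sup>*" if "i < length vs" for i
    using that
  proof (induction i)
    case (Suc i)
    then have "(vs ! i, vs ! Suc i) \<in> adj_rel adj (set vs)"
      using adj[of i] by (auto simp: adj_rel_def)
    then show ?case using Suc by (meson Suc_lessD rtrancl.simps)
  qed simp
  have "sym (adj_rel adj (set vs))"
    using assms(2) by (auto simp: adj_rel_def sym_def dest: sympD)
  then have "sym ((adj_rel adj (set vs))\<^sup>*)" by (rule sym_rtrancl)
  then have "(vs ! i, vs ! j) \<in> (adj_rel adj (set vs))\<^sup>*" if "i < length vs" "j < length vs" for i j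
    using fwd[OF that(1)] fwd[OF that(2)] by (blast dest: symD intro: rtrancl_trans)
  then show ?thesis by (auto simp: connected_in_def in_set_conv_nth)
qed

text \<open>A longest path in \<open>K\<close> closes up: by maximality all neighbours of its last
  vertex lie on it, and the neighbour other than the penultimate vertex must be the first one, since
  an interior vertex would get a third neighbour. The resulting cycle cannot be left along an edge,
  so connectedness makes it all of \<open>K\<close>.\<close>

lemma two_regular_connected_cycle:
  assumes fin: "finite K" and ne: "K \<noteq> {}" and "symp adj" and irr: "\<And>v. \<not> adj v v"
    and deg: "\<And>v. v \<in> K \<Longrightarrow> card {w \<in> K. adj v w} = 2"
    and con: "connected_in adj K"
  shows "is_cycle (induced adj K)"
proof -
  let ?P = "\<lambda>xs. distinct xs \<and> set xs \<subseteq> K \<and> xs \<noteq> [] \<and> successively adj xs"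
  obtain a where "a \<in> K" using ne by auto
  then have "?P [a]" by simp
  moreover have "\<forall>xs. ?P xs \<longrightarrow> length xs \<le> card K"
    using fin by (metis card_mono distinct_card)
  ultimately obtain vs where P: "?P vs" and max: "\<And>xs. ?P xs \<Longrightarrow> length xs \<le> length vs"
    using ex_has_greatest_nat[of ?P "[a]" length "Suc (card K)"] less_Suc_eq_le by blast
  let ?n = "length vs"
  have step: "adj (vs ! i) (vs ! Suc i)" if "Suc i < ?n" for i
    using P that by (simp add: successively_conv_nth)
  have K: "vs ! i \<in> K" if "i < ?n" for i using P that by auto
  have nbrs: "w \<in> set vs" if "w \<in> K" "adj (last vs) w" for w
  proof (rule ccontr)
    assume "w \<notin> set vs"
    then have "?P (vs @ [w])" using P that by (auto simp: successively_append_iff)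
    then show False using max by fastforce
  qed
  have last: "last vs = vs ! (?n - 1)" "?n - 1 < ?n" using P by (auto simp: last_conv_nth)
  obtain b c where bc: "b \<noteq> c" "{w \<in> K. adj (last vs) w} = {b, c}"
    using deg[OF K[OF last(2)], folded last(1)] unfolding card_2_iff by blast
  have "{last vs, b, c} \<subseteq> set vs" using bc nbrs P by auto
  moreover have "card {last vs, b, c} = 3" using bc irr by (auto simp: card_insert_if)
  ultimately have n3: "3 \<le> ?n" using P by (metis card_mono distinct_card finite_set)
  have "Suc (?n - 2) = ?n - 1" using n3 by simp
  then have pen: "adj (last vs) (vs ! (?n - 2))"
    using step[of "?n - 2"] last sympD[OF assms(3)] by (simp del: One_nat_def)
  have "\<exists>w\<in>{b, c}. w \<noteq> vs ! (?n - 2)" using bc(1) by auto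
  then obtain w where w: "w \<in> K" "adj (last vs) w" "w \<noteq> vs ! (?n - 2)" using bc(2) by blast
  then obtain i where i: "i < ?n" "w = vs ! i" using nbrs[OF w(1,2)] by (auto simp: in_set_conv_nth)
  have "i = 0"
  proof (rule ccontr)
    assume i0: "i \<noteq> 0"
    have "i \<noteq> ?n - 1" using w i irr last by auto
    moreover have "i \<noteq> ?n - 2" using w i by auto
    ultimately have il: "Suc i < ?n - 1" using i n3 by auto
    have "{vs ! (i - 1), vs ! Suc i, vs ! (?n - 1)} \<subseteq> {w \<in> K. adj (vs ! i) w}"
      using step[of "i - 1"] step[of i] i0 il w i last K assms(3) by (auto dest: sympD)
    moreover have "card {vs ! (i - 1), vs ! Suc i, vs ! (?n - 1)} = 3"
      using P i0 il by (simp add: card_insert_if nth_eq_iff_index_eq) linarith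
    moreover have "finite {w \<in> K. adj (vs ! i) w}" using fin by simp
    ultimately have "3 \<le> card {w \<in> K. adj (vs ! i) w}" by (metis card_mono)
    then show False using deg K i by simp
  qed
  then have adj: "adj (vs ! j) (vs ! (Suc j mod ?n))" if "j < ?n" for j
  proof (cases "Suc j < ?n")
    case False
    then have "?n = Suc j" using that by simp
    then show ?thesis using w(2) i last \<open>i = 0\<close> by auto
  qed (use step in auto)
  have closed: "\<exists>j<?n. {vs ! i, w} = {vs ! j, vs ! (Suc j mod ?n)}"
    if "i < ?n" "w \<in> K" "adj (vs ! i) w" for i w
  proof (rule cycle_degree_closed[where V = K and adj = adj])
    show "finite {w \<in> K. adj v w} \<and> card {w \<in> K. adj v w} \<le> 2" if "v \<in> K" for v
      using fin deg that by simp
  qed (use P n3 assms(3) adj that in auto)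
  have modlt: "Suc j mod ?n < ?n" for j using n3 by (intro mod_less_divisor) auto
  have "K \<subseteq> set vs"
  proof (rule connected_in_closed[OF con])
    show "set vs \<inter> K \<noteq> {}" using P by (simp add: Int_absorb2)
  next
    fix x y assume x: "x \<in> set vs" "y \<in> K" "adj x y"
    then obtain i where i: "i < ?n" "x = vs ! i" by (auto simp: in_set_conv_nth)
    then obtain j where "j < ?n" "{x, y} = {vs ! j, vs ! (Suc j mod ?n)}"
      using closed[of i y] x by auto
    then show "y \<in> set vs" using modlt[of j] nth_mem[of j vs] nth_mem[OF modlt[of j]]
      by (metis insertCI insertE singletonD)
  qed
  then have vsK: "set vs = K" using P by auto
  have "{{a, b} | a b. a \<in> K \<and> b \<in> K \<and> adj a b} =
    {{vs ! i, vs ! (Suc i mod ?n)} | i. i < ?n}" (is "?l = ?r")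
  proof
    show "?l \<subseteq> ?r"
    proof
      fix e assume "e \<in> ?l"
      then obtain a b where ab: "e = {a, b}" "a \<in> set vs" "b \<in> K" "adj a b" using vsK by blast
      then obtain i where "i < ?n" "a = vs ! i" by (auto simp: in_set_conv_nth)
      then show "e \<in> ?r" using closed[of i b] ab by blast
    qed
    show "?r \<subseteq> ?l" using adj vsK modlt nth_mem by blast
  qed
  then have "induced adj K = cycle_through vs"
    by (simp add: induced_def cycle_through_def vsK)
  then show ?thesis using P n3 by (auto simp: is_cycle_def)
qed

section \<open>Families of cycles in a graph of maximum degree two\<close>

locale cycle_family =
  fixes adj :: "'a \<Rightarrow> 'a \<Rightarrow> bool" and V :: "'a set" and \<K> :: "'a set set"
  assumes fin: "finite V" and sym: "symp adj" and irr: "\<not> adj v v"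
    and deg: "v \<in> V \<Longrightarrow> card {w \<in> V. adj v w} \<le> 2"
    and sub: "K \<in> \<K> \<Longrightarrow> K \<subseteq> V" and ne: "K \<in> \<K> \<Longrightarrow> K \<noteq> {}"
    and deg2: "K \<in> \<K> \<Longrightarrow> v \<in> K \<Longrightarrow> 2 \<le> card {w \<in> K. adj v w}"
    and con: "K \<in> \<K> \<Longrightarrow> connected_in adj K"
begin

text \<open>A vertex of \<open>K\<close> has at least two neighbours in \<open>K\<close> and at most
  two in the whole graph, hence none outside \<open>K\<close>. Disjointness of different members is
  a consequence.\<close>

lemma closed:
  assumes "K \<in> \<K>" "v \<in> K"
  shows "{w \<in> V. adj v w} = {w \<in> K. adj v w}"
proof -
  have "{w \<in> K. adj v w} \<subseteq> {w \<in> V. adj v w}" using sub assms by auto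
  moreover have "v \<in> V" using sub assms by auto
  ultimately show ?thesis
    using card_seteq[of "{w \<in> V. adj v w}" "{w \<in> K. adj v w}"] fin deg[of v] deg2[OF assms]
    by fastforce
qed

lemma closedD: "K \<in> \<K> \<Longrightarrow> v \<in> K \<Longrightarrow> w \<in> V \<Longrightarrow> adj v w \<Longrightarrow> w \<in> K"
  using closed by blast

lemma disjoint:
  assumes "K \<in> \<K>" "K' \<in> \<K>" "K \<inter> K' \<noteq> {}" shows "K = K'"
proof
  show "K \<subseteq> K'"
    by (rule connected_in_closed[OF con[OF assms(1)]])
      (use assms sub[OF assms(1)] closedD[OF assms(2)] in auto)
  show "K' \<subseteq> K"
    by (rule connected_in_closed[OF con[OF assms(2)]])
      (use assms sub[OF assms(2)] closedD[OF assms(1)] in auto)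
qed

lemma card_nbrs: "K \<in> \<K> \<Longrightarrow> v \<in> K \<Longrightarrow> card {w \<in> K. adj v w} = 2"
  using closed[of K v] deg[of v] deg2[of K v] sub[of K] by (auto simp: subset_iff intro: antisym)

text \<open>The first vertex of the cycle has a neighbour, so it lies in some \<open>K\<close>. Both
  the cycle and \<open>K\<close> are connected and neither can be left along an edge, so their
  vertex sets agree; the edges agree because the cycle has no chords.\<close>

lemma cycle_closed:
  assumes "D \<in> cycles_of (induced adj V)" and cov: "{v \<in> V. \<exists>w\<in>V. adj v w} \<subseteq> \<Union>\<K>"
  shows "\<exists>K\<in>\<K>. D = induced adj K"
proof -
  obtain vs where vs: "distinct vs" "3 \<le> length vs" "D = cycle_through vs"
    and subg: "subgraph_of D (induced adj V)"
    using assms(1) by (auto simp: cycles_of_def is_cycle_def)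
  let ?n = "length vs"
  have vsV: "set vs \<subseteq> V" using subg vs by (simp add: subgraph_of_def induced_def cycle_through_def)
  have adj: "adj (vs ! i) (vs ! (Suc i mod ?n))" if "i < ?n" for i
  proof -
    have "{vs ! i, vs ! (Suc i mod ?n)} \<in> edges D" using that vs by (auto simp: cycle_through_def)
    then have "{vs ! i, vs ! (Suc i mod ?n)} \<in> edges (induced adj V)"
      using subg by (auto simp: subgraph_of_def)
    then obtain a b where "{vs ! i, vs ! (Suc i mod ?n)} = {a, b}" "adj a b"
      by (auto simp: induced_def)
    then show ?thesis using sym by (auto simp: doubleton_eq_iff dest: sympD)
  qed
  have cl: "\<exists>j<?n. {vs ! i, w} = {vs ! j, vs ! (Suc j mod ?n)}"
    if "i < ?n" "w \<in> V" "adj (vs ! i) w" for i w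
    by (rule cycle_degree_closed[where V = V and adj = adj])
      (use vs vsV sym adj that fin deg in auto)
  have modlt: "Suc j mod ?n < ?n" for j using vs by (intro mod_less_divisor) auto
  have n0: "0 < ?n" using vs(2) by auto
  then have "vs ! 0 \<in> V" "vs ! (Suc 0 mod ?n) \<in> V" using vsV modlt nth_mem by blast+
  then obtain K where K: "K \<in> \<K>" "vs ! 0 \<in> K"
    using adj[of 0] cov n0 by blast
  have inter: "set vs \<inter> K \<noteq> {}" using K n0 nth_mem by blast
  have "set vs \<subseteq> K"
  proof (rule connected_in_closed[OF cycle_connected[OF adj sym]])
    show "K \<inter> set vs \<noteq> {}" using inter by blast
  qed (use K(1) closedD vsV in auto)
  moreover have "K \<subseteq> set vs"
  proof (rule connected_in_closed[OF con[OF K(1)] inter])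
    fix x y assume x: "x \<in> set vs" "y \<in> K" "adj x y"
    then obtain i where i: "i < ?n" "x = vs ! i" by (auto simp: in_set_conv_nth)
    then obtain j where "j < ?n" "{x, y} = {vs ! j, vs ! (Suc j mod ?n)}"
      using cl[of i y] x sub[OF K(1)] by auto
    then show "y \<in> set vs" using modlt[of j] nth_mem[of j vs] nth_mem[OF modlt[of j]]
      by (metis insertCI insertE singletonD)
  qed
  ultimately have vsK: "set vs = K" by simp
  have "{{a, b} | a b. a \<in> K \<and> b \<in> K \<and> adj a b} =
    {{vs ! i, vs ! (Suc i mod ?n)} | i. i < ?n}" (is "?l = ?r")
  proof
    show "?l \<subseteq> ?r"
    proof
      fix e assume "e \<in> ?l"
      then obtain a b where ab: "e = {a, b}" "a \<in> set vs" "b \<in> V" "adj a b" using vsK vsV by blast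
      then obtain i where "i < ?n" "a = vs ! i" by (auto simp: in_set_conv_nth)
      then show "e \<in> ?r" using cl[of i b] ab by blast
    qed
    show "?r \<subseteq> ?l" using adj vsK modlt nth_mem by blast
  qed
  then show ?thesis using K vs vsK by (auto simp: induced_def cycle_through_def)
qed

lemma cycles_of_induced:
  assumes "{v \<in> V. \<exists>w\<in>V. adj v w} \<subseteq> \<Union>\<K>"
  shows "cycles_of (induced adj V) = induced adj ` \<K>"
proof
  show "cycles_of (induced adj V) \<subseteq> induced adj ` \<K>" 
  proof
    fix D assume "D \<in> cycles_of (induced adj V)"
    from cycle_closed[OF this assms] show "D \<in> induced adj ` \<K>" by (rule bexE) simp
  qed
  show "induced adj ` \<K> \<subseteq> cycles_of (induced adj V)"
  proof safe
    fix K assume K: "K \<in> \<K>"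
    have "is_cycle (induced adj K)"
      using finite_subset[OF sub[OF K] fin] ne[OF K] sym irr card_nbrs[OF K] con[OF K]
      by (rule two_regular_connected_cycle)
    moreover have "subgraph_of (induced adj K) (induced adj V)"
      using sub[OF K] by (auto simp: subgraph_of_def induced_def)
    ultimately show "induced adj K \<in> cycles_of (induced adj V)" by (simp add: cycles_of_def)
  qed
qed

end

section \<open>Symmetric shapes and their lifts\<close>

text \<open>The integer counterpart of \<open>leaper_move\<close>, to which it is linked by
  \<open>leaper_move_iff_leap\<close>. With integer parameters, differences such as
  \<open>2 * q - p\<close> are not truncated, and the absolute values make invariance under the
  symmetries of the square immediate.\<close>

definition leap :: "int \<Rightarrow> int \<Rightarrow> square \<Rightarrow> square \<Rightarrow> bool" where
  "leap p q a b \<longleftrightarrow>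
     \<bar>fst b - fst a\<bar> = p \<and> \<bar>snd b - snd a\<bar> = q \<or> \<bar>fst b - fst a\<bar> = q \<and> \<bar>snd b - snd a\<bar> = p"

lemma leap_commute: "leap p q a b \<longleftrightarrow> leap p q b a"
  by (auto simp: leap_def abs_minus_commute)

lemma symp_leap: "symp (leap p q)"
  by (auto simp: symp_def leap_commute)

lemma leap_swap: "leap p q (prod.swap a) (prod.swap b) \<longleftrightarrow> leap p q a b"
  by (auto simp: leap_def)

lemma abs_eq_sign: "\<bar>x\<bar> = p \<Longrightarrow> \<exists>a\<in>{1, -1}. x = a * (p :: int)"
  by (cases "x < 0") auto

lemma sign_uminus: "a \<in> {1, -1 :: int} \<Longrightarrow> - a \<in> {1, -1}"
  by auto

text \<open>Squares are taken relative to the centre of the shape. Allowing for the slack \<open>d\<close>, a coordinate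
  \<open>x\<close> lies in the middle range if \<open>\<bar>2 * x\<bar> \<le> q - p - d\<close> and in the outer range of sign \<open>a\<close> if
  \<open>q - p + d \<le> 2 * (a * x)\<close>. Within a shape, \<open>p - q + d \<le> 2 * (a * x)\<close> says that \<open>x\<close> is not in the
  outer range of sign \<open>- a\<close>.\<close>

locale shape =
  fixes p q d :: int and S :: "square set"
  assumes p: "0 \<le> p" and pq: "p < q" and d: "0 < d"
    and zone1: "(x, y) \<in> S \<Longrightarrow> \<bar>2 * x\<bar> \<le> p + q - d \<and> (\<bar>2 * x\<bar> \<le> q - p - d \<or> q - p + d \<le> \<bar>2 * x\<bar>)"
    and swap: "(x, y) \<in> S \<Longrightarrow> (y, x) \<in> S"
    and neg: "(x, y) \<in> S \<Longrightarrow> (- x, y) \<in> S"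
    and step: "\<lbrakk>(x, y) \<in> S; a \<in> {1, -1}; b \<in> {1, -1}; 2 * (a * x) \<le> q - p - d; q - p + d \<le> 2 * (b * y)\<rbrakk>
      \<Longrightarrow> (x + a * p, y - b * q) \<in> S"
    and con: "connected_in (leap p q) S"
    and ne: "S \<noteq> {}"
begin

lemma zone2: "(x, y) \<in> S \<Longrightarrow> \<bar>2 * y\<bar> \<le> p + q - d \<and> (\<bar>2 * y\<bar> \<le> q - p - d \<or> q - p + d \<le> \<bar>2 * y\<bar>)"
  using zone1 swap by blast

lemma step_swap:
  "\<lbrakk>(x, y) \<in> S; a \<in> {1, -1}; b \<in> {1, -1}; 2 * (b * y) \<le> q - p - d; q - p + d \<le> 2 * (a * x)\<rbrakk>
    \<Longrightarrow> (x - a * q, y + b * p) \<in> S"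
  using swap step by blast

text \<open>The assumption \<open>step\<close> lists leaps whose targets must belong to the shape.
  Conversely, every leap inside the shape is of that form up to exchanging coordinates, since the
  bound of \<open>zone1\<close> at the target forces the two inequalities at the source.\<close>

lemma edge_cases:
  assumes "(z, z') \<in> adj_rel (leap p q) S"
  obtains x y a b where "a \<in> {1, -1}" "b \<in> {1, -1}" "2 * (a * x) \<le> q - p - d" "q - p + d \<le> 2 * (b * y)"
      "(x, y) \<in> S" "(x + a * p, y - b * q) \<in> S"
      "(z, z') = ((x, y), (x + a * p, y - b * q)) \<or>
       (z, z') = ((y, x), (y - b * q, x + a * p))"
proof -
  have *: "\<exists>a\<in>{1, -1}. \<exists>b\<in>{1, -1}. 2 * (a * x) \<le> q - p - d \<and> q - p + d \<le> 2 * (b * y) \<and>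
      x' = x + a * p \<and> y' = y - b * q"
    if h: "(x, y) \<in> S" "(x', y') \<in> S" "\<bar>x' - x\<bar> = p" "\<bar>y' - y\<bar> = q" for x y x' y'
  proof -
    obtain a where a: "a \<in> {1, -1}" "x' - x = a * p" using abs_eq_sign[of "x' - x" p] h(3) by blast
    obtain b where b: "b \<in> {1, -1}" "y - y' = b * q"
      using abs_eq_sign[of "y - y'" q] h(4) by (metis abs_minus_commute)
    have "2 * (a * x) \<le> q - p - d" using a zone1[OF h(2)] by auto
    moreover have "q - p + d \<le> 2 * (b * y)" using b zone2[OF h(2)] by auto
    moreover have "x' = x + a * p" "y' = y - b * q" using a b by simp_all
    ultimately show ?thesis using a b by blast
  qed
  obtain u v u' v' where z: "z = (u, v)" "z' = (u', v')" by (cases z, cases z')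
  have S: "(u, v) \<in> S" "(u', v') \<in> S" and l: "leap p q (u, v) (u', v')"
    using assms z by (auto simp: adj_rel_def)
  from l consider "\<bar>u' - u\<bar> = p" "\<bar>v' - v\<bar> = q" | "\<bar>v' - v\<bar> = p" "\<bar>u' - u\<bar> = q"
    by (auto simp: leap_def)
  then show thesis
  proof cases
    case 1
    from *[OF S 1] obtain a b where "a \<in> {1, -1}" "b \<in> {1, -1}" "2 * (a * u) \<le> q - p - d"
      "q - p + d \<le> 2 * (b * v)" "u' = u + a * p" "v' = v - b * q" by blast
    then show thesis using that[of a b u v] S z by simp
  next
    case 2
    from *[OF swap[OF S(1)] swap[OF S(2)] 2] obtain a b where "a \<in> {1, -1}" "b \<in> {1, -1}"
      "2 * (a * v) \<le> q - p - d" "q - p + d \<le> 2 * (b * u)" "v' = v + a * p" "u' = u - b * q" by blast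
    then show thesis using that[of a b v u] swap[OF S(1)] swap[OF S(2)] z by simp
  qed
qed

end

text \<open>\<open>rep_F p q d z w\<close> says that \<open>w\<close> is one of the squares that
  replace \<open>z\<close>. A corner representative and a side representative with matching signs
  differ, up to signs and order, by \<open>(p, 2 * p + q)\<close> here, by
  \<open>(q, 2 * q - p)\<close> for \<open>rep_G\<close> and by \<open>(q, p + 2 * q)\<close> for
  \<open>rep_H\<close>: these are leaps of the new leaper. Under \<open>rep_F\<close>, a square with
  both coordinates in the middle range has no representative.\<close>

inductive rep_F :: "int \<Rightarrow> int \<Rightarrow> int \<Rightarrow> square \<Rightarrow> square \<Rightarrow> bool" for p q d where
  F_xy: "\<lbrakk>a \<in> {1, -1}; b \<in> {1, -1}; q - p + d \<le> 2 * (a * x); q - p + d \<le> 2 * (b * y)\<rbrakk>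
    \<Longrightarrow> rep_F p q d (x, y) (x + a * p, y + b * p)"
| F_y: "\<lbrakk>b \<in> {1, -1}; q - p + d \<le> 2 * (b * y)\<rbrakk> \<Longrightarrow> rep_F p q d (x, y) (x, y - b * (p + q))"
| F_x: "\<lbrakk>a \<in> {1, -1}; q - p + d \<le> 2 * (a * x)\<rbrakk> \<Longrightarrow> rep_F p q d (x, y) (x - a * (p + q), y)"

inductive rep_G :: "int \<Rightarrow> int \<Rightarrow> int \<Rightarrow> square \<Rightarrow> square \<Rightarrow> bool" for p q d where
  G_xy: "\<lbrakk>a \<in> {1, -1}; b \<in> {1, -1}; p - q + d \<le> 2 * (a * x); p - q + d \<le> 2 * (b * y)\<rbrakk>
    \<Longrightarrow> rep_G p q d (x, y) (x - a * q, y - b * q)"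
| G_y: "\<lbrakk>b \<in> {1, -1}; p - q + d \<le> 2 * (b * y); \<bar>2 * x\<bar> \<le> q - p - d\<rbrakk>
    \<Longrightarrow> rep_G p q d (x, y) (x, y + b * (q - p))"
| G_x: "\<lbrakk>a \<in> {1, -1}; p - q + d \<le> 2 * (a * x); \<bar>2 * y\<bar> \<le> q - p - d\<rbrakk>
    \<Longrightarrow> rep_G p q d (x, y) (x + a * (q - p), y)"

inductive rep_H :: "int \<Rightarrow> int \<Rightarrow> int \<Rightarrow> square \<Rightarrow> square \<Rightarrow> bool" for p q d where
  H_xy: "\<lbrakk>a \<in> {1, -1}; b \<in> {1, -1}; p - q + d \<le> 2 * (a * x); p - q + d \<le> 2 * (b * y)\<rbrakk>
    \<Longrightarrow> rep_H p q d (x, y) (x + a * q, y + b * q)"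
| H_y: "\<lbrakk>b \<in> {1, -1}; p - q + d \<le> 2 * (b * y)\<rbrakk> \<Longrightarrow> rep_H p q d (x, y) (x, y - b * (p + q))"
| H_x: "\<lbrakk>a \<in> {1, -1}; p - q + d \<le> 2 * (a * x)\<rbrakk> \<Longrightarrow> rep_H p q d (x, y) (x - a * (p + q), y)"

fun rep :: "op_type \<Rightarrow> int \<Rightarrow> int \<Rightarrow> int \<Rightarrow> square \<Rightarrow> square \<Rightarrow> bool" where
  "rep F = rep_F" | "rep G = rep_G" | "rep H = rep_H"

definition lift :: "op_type \<Rightarrow> int \<Rightarrow> int \<Rightarrow> int \<Rightarrow> square set \<Rightarrow> square set" where
  "lift c p q d S = {w. \<exists>z\<in>S. rep c p q d z w}"

lemma lift_iff: "w \<in> lift c p q d S \<longleftrightarrow> (\<exists>z\<in>S. rep c p q d z w)"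
  by (simp add: lift_def)

lemma liftI: "rep c p q d z w \<Longrightarrow> z \<in> S \<Longrightarrow> w \<in> lift c p q d S"
  by (auto simp: lift_def)

lemma rep_swap: "rep c p q d (x, y) (u, v) \<Longrightarrow> rep c p q d (y, x) (v, u)"
  by (cases c)
    (simp; erule rep_F.cases rep_G.cases rep_H.cases; simp;
      blast intro: rep_F.intros rep_G.intros rep_H.intros)+

lemma rep_neg: "rep c p q d (x, y) (u, v) \<Longrightarrow> rep c p q d (- x, y) (- u, v)"
proof (cases c)
  case F
  assume "rep c p q d (x, y) (u, v)"
  then have "rep_F p q d (x, y) (u, v)" using F by simp
  then have "rep_F p q d (- x, y) (- u, v)"
  proof cases
    case (F_xy a b)
    then show ?thesis using rep_F.F_xy[of "- a" b q p d "- x" y] by auto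
  next
    case (F_y b)
    then show ?thesis using rep_F.F_y[of b q p d y "- x"] by simp
  next
    case (F_x a)
    then show ?thesis using rep_F.F_x[of "- a" q p d "- x" y] by auto
  qed
  then show ?thesis using F by simp
next
  case G
  assume "rep c p q d (x, y) (u, v)"
  then have "rep_G p q d (x, y) (u, v)" using G by simp
  then have "rep_G p q d (- x, y) (- u, v)"
  proof cases
    case (G_xy a b)
    then show ?thesis using rep_G.G_xy[of "- a" b p q d "- x" y] by auto
  next
    case (G_y b)
    then show ?thesis using rep_G.G_y[of b p q d y "- x"] by simp
  next
    case (G_x a)
    then show ?thesis using rep_G.G_x[of "- a" p q d "- x" y] by auto
  qed
  then show ?thesis using G by simp
next
  case H
  assume "rep c p q d (x, y) (u, v)"
  then have "rep_H p q d (x, y) (u, v)" using H by simp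
  then have "rep_H p q d (- x, y) (- u, v)"
  proof cases
    case (H_xy a b)
    then show ?thesis using rep_H.H_xy[of "- a" b p q d "- x" y] by auto
  next
    case (H_y b)
    then show ?thesis using rep_H.H_y[of b p q d y "- x"] by simp
  next
    case (H_x a)
    then show ?thesis using rep_H.H_x[of "- a" p q d "- x" y] by auto
  qed
  then show ?thesis using H by simp
qed

text \<open>Each old square becomes a cluster of representatives connected through a hub, and each
  old edge yields a new edge between the two clusters, so a path of old squares lifts to a path
  through their clusters.\<close>

lemma connected_lift:
  assumes con: "connected_in r S" and "symp r'"
    and hub: "\<And>z. z \<in> S \<Longrightarrow> \<exists>h. R z h \<and> (\<forall>w. R z w \<longrightarrow> (w, h) \<in> (adj_rel r' S')\<^sup>*)"
    and edge: "\<And>z z'. (z, z') \<in> adj_rel r S \<Longrightarrow> \<exists>w w'. R z w \<and> R z' w' \<and> r' w w'"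
    and S': "\<And>w. w \<in> S' \<longleftrightarrow> (\<exists>z\<in>S. R z w)"
  shows "connected_in r' S'"
proof -
  let ?A = "(adj_rel r' S')\<^sup>*"
  have "sym (adj_rel r' S')" using assms(2) by (auto simp: adj_rel_def sym_def dest: sympD)
  then have sym: "sym ?A" by (rule sym_rtrancl)
  have same: "(w, w') \<in> ?A" if "z \<in> S" "R z w" "R z w'" for z w w'
    using hub[OF that(1)] that by (meson rtrancl_trans sym symD)
  have "\<forall>w w'. R z w \<longrightarrow> R z' w' \<longrightarrow> (w, w') \<in> ?A"
    if "z \<in> S" "(z, z') \<in> (adj_rel r S)\<^sup>*" for z z'
    using that(2)
  proof (induction rule: rtrancl_induct)
    case base
    then show ?case using same that(1) by blast
  next
    case (step y z')
    obtain v v' where v: "R y v" "R z' v'" "r' v v'" using edge step(2) by blast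
    have S: "y \<in> S" "z' \<in> S" using step(2) by (auto simp: adj_rel_def)
    then have "(v, v') \<in> ?A" using v S' by (auto simp: adj_rel_def)
    then show ?case using step(3) v same S by (meson rtrancl_trans)
  qed
  then have "(w, w') \<in> ?A" if "z \<in> S" "z' \<in> S" "R z w" "R z' w'" for z z' w w'
    using con that unfolding connected_in_def by blast
  then show ?thesis unfolding connected_in_def using S' by meson
qed

text \<open>The only improper shape of interest is the origin alone.\<close>

locale proper_shape = shape +
  assumes proper: "(x, y) \<in> S \<Longrightarrow> q - p + d \<le> \<bar>2 * x\<bar> \<or> q - p + d \<le> \<bar>2 * y\<bar>"

section \<open>Lifted shapes are proper shapes\<close>

context shape begin

lemma lift_swap: "(x, y) \<in> lift c p q d S \<Longrightarrow> (y, x) \<in> lift c p q d S"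
  unfolding lift_iff using rep_swap swap by (metis surj_pair)

lemma lift_neg: "(x, y) \<in> lift c p q d S \<Longrightarrow> (- x, y) \<in> lift c p q d S"
  unfolding lift_iff using rep_neg neg by (metis surj_pair)

lemma ext_sign: "(x, y) \<in> S \<Longrightarrow> \<exists>a\<in>{1, -1}. p - q + d \<le> 2 * (a * x)"
  using zone1[of x y] p pq d by (cases "x < 0") auto

lemma ext_sign2: "(x, y) \<in> S \<Longrightarrow> \<exists>b\<in>{1, -1}. p - q + d \<le> 2 * (b * y)"
  using zone2[of x y] p pq d by (cases "y < 0") auto

lemma mid_of_two_signs:
  assumes "a \<in> {1, -1}" "a' \<in> {1, -1}" "a \<noteq> a'" "p - q + d \<le> 2 * (a * x)" "p - q + d \<le> 2 * (a' * x)"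
  shows "\<bar>2 * x\<bar> \<le> q - p - d"
  using assms by auto

text \<open>This reduces the edge condition of \<open>connected_lift\<close> to the leaps of
  \<open>step\<close>. The transposed leaps are covered because \<open>rep\<close> and
  \<open>leap\<close> are invariant under exchanging coordinates.\<close>

lemma rep_edge:
  assumes edge: "\<And>x y a b. \<lbrakk>a \<in> {1, -1}; b \<in> {1, -1}; 2 * (a * x) \<le> q - p - d; q - p + d \<le> 2 * (b * y);
      (x, y) \<in> S; (x + a * p, y - b * q) \<in> S\<rbrakk>
      \<Longrightarrow> \<exists>w w'. rep c p q d (x, y) w \<and> rep c p q d (x + a * p, y - b * q) w' \<and> leap p' q' w w'"
    and zz': "(z, z') \<in> adj_rel (leap p q) S"
  shows "\<exists>w w'. rep c p q d z w \<and> rep c p q d z' w' \<and> leap p' q' w w'"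
proof -
  from zz' obtain x y a b where h: "a \<in> {1, -1}" "b \<in> {1, -1}" "2 * (a * x) \<le> q - p - d"
    "q - p + d \<le> 2 * (b * y)" "(x, y) \<in> S" "(x + a * p, y - b * q) \<in> S"
    and z: "(z, z') = ((x, y), (x + a * p, y - b * q)) \<or> (z, z') = ((y, x), (y - b * q, x + a * p))"
    by (rule edge_cases)
  obtain w w' where w: "rep c p q d (x, y) w" "rep c p q d (x + a * p, y - b * q) w'" "leap p' q' w w'"
    using edge[OF h] by blast
  from z show ?thesis
  proof (elim disjE)
    assume "(z, z') = ((x, y), (x + a * p, y - b * q))"
    then show ?thesis using w by blast
  next
    assume z: "(z, z') = ((y, x), (y - b * q, x + a * p))"
    have "rep c p q d z (prod.swap w)" "rep c p q d z' (prod.swap w')"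
      using z w rep_swap[of c p q d x y "fst w" "snd w"]
        rep_swap[of c p q d "x + a * p" "y - b * q" "fst w'" "snd w'"]
      by (simp_all add: prod.swap_def)
    then show ?thesis using w(3) leap_swap by blast
  qed
qed

lemma lift_ne:
  assumes "\<And>x y. (x, y) \<in> S \<Longrightarrow> \<exists>w. rep c p q d (x, y) w"
  shows "lift c p q d S \<noteq> {}"
proof -
  obtain x y where S: "(x, y) \<in> S" using ne by fast
  then obtain w where "rep c p q d (x, y) w" using assms by blast
  then have "w \<in> lift c p q d S" using S by (rule liftI)
  then show ?thesis by blast
qed

text \<open>The closure under \<open>step\<close> holds because a leap of the new leaper from a
  representative of a square ends at a representative of the same square or, if that square lacks
  the one in question, at a representative of an old neighbour. The lifts for \<open>G\<close> and
  \<open>F\<close> follow the same pattern.\<close>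

lemma proper_shape_lift_H: "proper_shape q (p + 2 * q) d (lift H p q d S)"
proof unfold_locales
  let ?S = "lift H p q d S"
  have xy: "(x + a * q, y + b * q) \<in> ?S"
    if "(x, y) \<in> S" "a \<in> {1, -1}" "b \<in> {1, -1}" "p - q + d \<le> 2 * (a * x)" "p - q + d \<le> 2 * (b * y)" for x y a b
    using liftI[of H, OF _ that(1)] rep_H.H_xy[OF that(2-5)] by simp
  have y: "(x, y - b * (p + q)) \<in> ?S"
    if "(x, y) \<in> S" "b \<in> {1, -1}" "p - q + d \<le> 2 * (b * y)" for x y b
    using liftI[of H, OF _ that(1)] rep_H.H_y[OF that(2-3)] by simp
  have x: "(x - a * (p + q), y) \<in> ?S"
    if "(x, y) \<in> S" "a \<in> {1, -1}" "p - q + d \<le> 2 * (a * x)" for x y a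
    using liftI[of H, OF _ that(1)] rep_H.H_x[OF that(2-3)] by simp
  have zones: "\<bar>2 * x'\<bar> \<le> q + (p + 2 * q) - d \<and>
      (\<bar>2 * x'\<bar> \<le> p + 2 * q - q - d \<or> p + 2 * q - q + d \<le> \<bar>2 * x'\<bar>) \<and>
      (p + 2 * q - q + d \<le> \<bar>2 * x'\<bar> \<or> p + 2 * q - q + d \<le> \<bar>2 * y'\<bar>)"
    if w: "(x', y') \<in> ?S" for x' y'
  proof -
    obtain z where z: "z \<in> S" "rep_H p q d z (x', y')" using w unfolding lift_iff rep.simps by blast
    from z(2) show ?thesis
    proof cases
      case (H_xy a b x y)
      then show ?thesis using zone1[of x y] z(1) p pq by auto
    next
      case (H_y b y)
      then show ?thesis using zone1[of x' y] zone2[of x' y] z(1) p pq d by auto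
    next
      case (H_x a x)
      then show ?thesis using zone1[of x y'] zone2[of x y'] z(1) p pq d by auto
    qed
  qed
  then show "\<bar>2 * x'\<bar> \<le> q + (p + 2 * q) - d \<and>
      (\<bar>2 * x'\<bar> \<le> p + 2 * q - q - d \<or> p + 2 * q - q + d \<le> \<bar>2 * x'\<bar>)"
    and "p + 2 * q - q + d \<le> \<bar>2 * x'\<bar> \<or> p + 2 * q - q + d \<le> \<bar>2 * y'\<bar>"
    if "(x', y') \<in> ?S" for x' y'
    using that by blast+
  show "(x' + a' * q, y' - b' * (p + 2 * q)) \<in> ?S"
    if h: "(x', y') \<in> ?S" "a' \<in> {1, -1}" "b' \<in> {1, -1}"
      "2 * (a' * x') \<le> p + 2 * q - q - d" "p + 2 * q - q + d \<le> 2 * (b' * y')" for x' y' a' b'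
  proof -
    obtain z where z: "z \<in> S" "rep_H p q d z (x', y')" using h(1) unfolding lift_iff rep.simps by blast
    from z(2) show ?thesis
    proof cases
      case (H_xy a b x y)
      have "b' = b" "a' = - a" using H_xy h(2-5) zone2[of x y] z(1) p pq d by auto
      then show ?thesis using y[of x y b] H_xy z(1) by (simp add: algebra_simps)
    next
      case (H_y b y)
      have S: "(x', y) \<in> S" using z(1) H_y by simp
      have b': "b' = - b" using H_y h(2-5) zone2[OF S] p pq d by auto
      have y': "y' - b' * (p + 2 * q) = y + b * q" using H_y b' by (simp add: algebra_simps)
      show ?thesis
      proof (cases "p - q + d \<le> 2 * (a' * x')")
        case True
        then show ?thesis using xy[OF S h(2) H_y(3) True H_y(4)] by (simp only: y')
      next
        case False
        \<comment> \<open>Here \<open>x'\<close> is in the outer range of sign \<open>- a'\<close>,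
          so the corner representative towards \<open>a'\<close> is missing. The target is instead
          the side representative, for sign \<open>- b\<close>, of the old neighbour
          \<open>(x' + a' * q, y - b * p)\<close>.\<close>
        then have "q - p + d \<le> 2 * (- a' * x')" using zone1[OF S] h(2) pq by auto
        moreover have "2 * (- b * y) \<le> q - p - d" using H_y by auto
        ultimately have "(x' + a' * q, y - b * p) \<in> S"
          using step_swap[OF S sign_uminus[OF h(2)] sign_uminus[OF H_y(3)]] by simp
        moreover have "p - q + d \<le> 2 * (- b * (y - b * p))"
          using H_y zone2[OF S] by auto
        ultimately have "(x' + a' * q, y - b * p - - b * (p + q)) \<in> ?S"
          using y[of "x' + a' * q" "y - b * p" "- b"] sign_uminus[OF H_y(3)] by blast
        moreover have "y - b * p - - b * (p + q) = y + b * q" by (simp add: algebra_simps)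
        ultimately show ?thesis by (simp only: y')
      qed
    next
      case (H_x a x)
      then show ?thesis using h(2-5) zone2[of x y'] z(1) p pq d by auto
    qed
  qed
  show "connected_in (leap q (p + 2 * q)) ?S"
  proof (rule connected_lift[OF con symp_leap, where R = "rep_H p q d"])
    fix z assume z: "z \<in> S"
    obtain x0 y0 where xy0: "z = (x0, y0)" by (cases z)
    obtain a where a: "a \<in> {1, -1}" "p - q + d \<le> 2 * (a * x0)" using ext_sign z xy0 by blast
    obtain b where b: "b \<in> {1, -1}" "p - q + d \<le> 2 * (b * y0)" using ext_sign2 z xy0 by blast
    let ?A = "adj_rel (leap q (p + 2 * q)) ?S"
    have e1: "((x0 + a * q, y0 + b * q), (x0, y0 - b * (p + q))) \<in> ?A"
      "((x0, y0 - b * (p + q)), (x0 + a * q, y0 + b * q)) \<in> ?A"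
      if "a \<in> {1, -1}" "b \<in> {1, -1}" "p - q + d \<le> 2 * (a * x0)" "p - q + d \<le> 2 * (b * y0)" for a b
      using xy[of x0 y0 a b] y[of x0 y0 b] that z xy0 p pq by (auto simp: adj_rel_def leap_def)
    have e2: "((x0 + a * q, y0 + b * q), (x0 - a * (p + q), y0)) \<in> ?A"
      "((x0 - a * (p + q), y0), (x0 + a * q, y0 + b * q)) \<in> ?A"
      if "a \<in> {1, -1}" "b \<in> {1, -1}" "p - q + d \<le> 2 * (a * x0)" "p - q + d \<le> 2 * (b * y0)" for a b
      using xy[of x0 y0 a b] x[of x0 y0 a] that z xy0 p pq by (auto simp: adj_rel_def leap_def)
    let ?h = "(x0 + a * q, y0 + b * q)"
    \<comment> \<open>The side representative \<open>(x0 - a * (p + q), y0)\<close> does not depend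
      on the second sign, so it joins the corner representatives for \<open>b'\<close> and
      \<open>b\<close>.\<close>
    have Y: "((x0, y0 - b' * (p + q)), ?h) \<in> ?A\<^sup>*"
      if "b' \<in> {1, -1}" "p - q + d \<le> 2 * (b' * y0)" for b'
      using e1(2)[OF a(1) that(1) a(2) that(2)] e2(1)[OF a(1) that(1) a(2) that(2)]
        e2(2)[OF a(1) b(1) a(2) b(2)] by (meson converse_rtrancl_into_rtrancl rtrancl.rtrancl_refl)
    show "\<exists>h. rep_H p q d z h \<and> (\<forall>w. rep_H p q d z w \<longrightarrow> (w, h) \<in> ?A\<^sup>*)"
    proof (intro exI[of _ ?h] conjI allI impI)
      show "rep_H p q d z ?h" using rep_H.H_xy a b xy0 by blast
      fix w assume "rep_H p q d z w"
      then show "(w, ?h) \<in> ?A\<^sup>*"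
      proof cases
        case (H_xy a' b' x y)
        then have "(w, (x0, y0 - b' * (p + q))) \<in> ?A" using e1(1)[of a' b'] xy0 by simp
        then show ?thesis using Y[of b'] H_xy xy0 by (simp add: converse_rtrancl_into_rtrancl)
      next
        case (H_y b' y x)
        then show ?thesis using Y[of b'] xy0 by simp
      next
        case (H_x a' x y)
        then have "(w, (x0 + a' * q, y0 + b * q)) \<in> ?A"
          "((x0 + a' * q, y0 + b * q), (x0, y0 - b * (p + q))) \<in> ?A"
          using e2(2)[of a' b] e1(1)[of a' b] b xy0 by simp_all
        then show ?thesis using Y[OF b] by (meson converse_rtrancl_into_rtrancl)
      qed
    qed
  next
    fix z z' assume zz': "(z, z') \<in> adj_rel (leap p q) S"
    show "\<exists>w w'. rep_H p q d z w \<and> rep_H p q d z' w' \<and> leap q (p + 2 * q) w w'"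
    proof (rule rep_edge[of H, unfolded rep.simps, OF _ zz'])
      fix x y a b
      assume h: "a \<in> {1, -1}" "b \<in> {1, -1}" "2 * (a * x) \<le> q - p - d"
        "q - p + d \<le> 2 * (b * y)" and S: "(x, y) \<in> S" "(x + a * p, y - b * q) \<in> S"
      \<comment> \<open>As \<open>x\<close> is not in the outer range of sign \<open>a\<close>, and
        \<open>x + a * p\<close> is not in that of sign \<open>- a\<close>, the two squares have
        these side representatives. They are \<open>p + 2 * q\<close> apart in the first coordinate
        and \<open>q\<close> in the second.\<close>
      let ?w = "(x + a * (p + q), y)" and ?w' = "(x + a * p - a * (p + q), y - b * q)"
      have "rep_H p q d (x, y) ?w"
        using rep_H.H_x[of "- a" p q d x y] h by auto
      moreover have "rep_H p q d (x + a * p, y - b * q) ?w'"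
        using rep_H.H_x[of a p q d "x + a * p" "y - b * q"] h zone1[OF S(1)] p pq d by auto
      moreover have "leap q (p + 2 * q) ?w ?w'" using h(1,2) p pq by (auto simp: leap_def)
      ultimately show "\<exists>w w'. rep_H p q d (x, y) w \<and> rep_H p q d (x + a * p, y - b * q) w' \<and>
          leap q (p + 2 * q) w w'" by blast
    qed
  qed (simp add: lift_iff)
  show "?S \<noteq> {}"
  proof (rule lift_ne)
    fix x y assume "(x, y) \<in> S"
    then obtain b where "b \<in> {1, -1}" "p - q + d \<le> 2 * (b * y)" using ext_sign2 by blast
    then show "\<exists>w. rep H p q d (x, y) w" using rep_H.H_y[of b p q d y x] by auto
  qed
qed (use p pq d lift_swap lift_neg in auto)

end

context shape begin

text \<open>Side representatives now require the other coordinate to be in the middle range. This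
  does not disconnect a cluster: two signs are admissible for a coordinate only if it is in the
  middle range, and then a side representative joins the corner representatives for both
  signs.\<close>

lemma proper_shape_lift_G: "proper_shape q (2 * q - p) d (lift G p q d S)"
proof unfold_locales
  let ?S = "lift G p q d S"
  have xy: "(x - a * q, y - b * q) \<in> ?S"
    if "(x, y) \<in> S" "a \<in> {1, -1}" "b \<in> {1, -1}" "p - q + d \<le> 2 * (a * x)" "p - q + d \<le> 2 * (b * y)" for x y a b
    using liftI[of G, OF _ that(1)] rep_G.G_xy[OF that(2-5)] by simp
  have y: "(x, y + b * (q - p)) \<in> ?S"
    if "(x, y) \<in> S" "b \<in> {1, -1}" "p - q + d \<le> 2 * (b * y)" "\<bar>2 * x\<bar> \<le> q - p - d" for x y b
    using liftI[of G, OF _ that(1)] rep_G.G_y[OF that(2-4)] by simp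
  have x: "(x + a * (q - p), y) \<in> ?S"
    if "(x, y) \<in> S" "a \<in> {1, -1}" "p - q + d \<le> 2 * (a * x)" "\<bar>2 * y\<bar> \<le> q - p - d" for x y a
    using liftI[of G, OF _ that(1)] rep_G.G_x[OF that(2-4)] by simp
  have zones: "\<bar>2 * x'\<bar> \<le> q + (2 * q - p) - d \<and>
      (\<bar>2 * x'\<bar> \<le> 2 * q - p - q - d \<or> 2 * q - p - q + d \<le> \<bar>2 * x'\<bar>) \<and>
      (2 * q - p - q + d \<le> \<bar>2 * x'\<bar> \<or> 2 * q - p - q + d \<le> \<bar>2 * y'\<bar>)"
    if w: "(x', y') \<in> ?S" for x' y'
  proof -
    obtain z where z: "z \<in> S" "rep_G p q d z (x', y')" using w unfolding lift_iff rep.simps by blast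
    from z(2) show ?thesis
    proof cases
      case (G_xy a b x y)
      then show ?thesis using zone1[of x y] z(1) p pq by auto
    next
      case (G_y b y)
      then show ?thesis using zone2[of x' y] z(1) p pq d by auto
    next
      case (G_x a x)
      then show ?thesis using zone1[of x y'] z(1) p pq d by auto
    qed
  qed
  then show "\<bar>2 * x'\<bar> \<le> q + (2 * q - p) - d \<and>
      (\<bar>2 * x'\<bar> \<le> 2 * q - p - q - d \<or> 2 * q - p - q + d \<le> \<bar>2 * x'\<bar>)"
    and "2 * q - p - q + d \<le> \<bar>2 * x'\<bar> \<or> 2 * q - p - q + d \<le> \<bar>2 * y'\<bar>"
    if "(x', y') \<in> ?S" for x' y'
    using that by blast+
  show "(x' + a' * q, y' - b' * (2 * q - p)) \<in> ?S"
    if h: "(x', y') \<in> ?S" "a' \<in> {1, -1}" "b' \<in> {1, -1}"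
      "2 * (a' * x') \<le> 2 * q - p - q - d" "2 * q - p - q + d \<le> 2 * (b' * y')" for x' y' a' b'
  proof -
    obtain z where z: "z \<in> S" "rep_G p q d z (x', y')" using h(1) unfolding lift_iff rep.simps by blast
    from z(2) show ?thesis
    proof cases
      case (G_xy a b x y)
      have S: "(x, y) \<in> S" using z(1) G_xy by simp
      have ab: "b' = - b" "a' = a" using G_xy h(2-5) zone1[OF S] zone2[OF S] p pq d by auto
      have x': "x' + a' * q = x" using G_xy ab by simp
      have y': "y' - b' * (2 * q - p) = y + b * (q - p)" using G_xy ab by (simp add: algebra_simps)
      show ?thesis
      proof (cases "\<bar>2 * x\<bar> \<le> q - p - d")
        case True
        then show ?thesis using y[OF S G_xy(5) G_xy(7)] unfolding x' y' by simp
      next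
        case False
        \<comment> \<open>Here \<open>x\<close> is in the outer range of sign \<open>a\<close>, so
          the side representative is missing. The target is the corner representative, for signs
          \<open>- a\<close> and \<open>- b\<close>, of the old neighbour
          \<open>(x - a * q, y - b * p)\<close>.\<close>
        then have "q - p + d \<le> 2 * (a * x)" using zone1[OF S] G_xy(4,6) pq by auto
        moreover have "2 * (- b * y) \<le> q - p - d" using G_xy(7) by simp
        ultimately have S': "(x - a * q, y - b * p) \<in> S"
          using step_swap[OF S G_xy(4) sign_uminus[OF G_xy(5)]] by simp
        have "p - q + d \<le> 2 * (- a * (x - a * q))" using G_xy(4) zone1[OF S] pq by auto
        moreover have "p - q + d \<le> 2 * (- b * (y - b * p))" using G_xy(5) zone2[OF S] by auto
        ultimately have "(x - a * q - - a * q, y - b * p - - b * q) \<in> ?S"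
          by (rule xy[OF S' sign_uminus[OF G_xy(4)] sign_uminus[OF G_xy(5)]])
        moreover have "x - a * q - - a * q = x" "y - b * p - - b * q = y + b * (q - p)"
          by (simp_all add: algebra_simps)
        ultimately show ?thesis by (simp only: x' y')
      qed
    next
      case (G_y b y)
      have S: "(x', y) \<in> S" using z(1) G_y by simp
      have b': "b' = b" using G_y h(2-5) p pq d by auto
      have y': "y' - b' * (2 * q - p) = y - b * q" using G_y b' by (simp add: algebra_simps)
      have "p - q + d \<le> 2 * (- a' * x')" using G_y h(2) by auto
      then have "(x' - - a' * q, y - b * q) \<in> ?S" by (rule xy[OF S sign_uminus[OF h(2)] G_y(3) _ G_y(4)])
      then show ?thesis unfolding y' by simp
    next
      case (G_x a x)
      then show ?thesis using h(2-5) d by auto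
    qed
  qed
  show "connected_in (leap q (2 * q - p)) ?S"
  proof (rule connected_lift[OF con symp_leap, where R = "rep_G p q d"])
    fix z assume z: "z \<in> S"
    obtain x0 y0 where xy0: "z = (x0, y0)" by (cases z)
    obtain a where a: "a \<in> {1, -1}" "p - q + d \<le> 2 * (a * x0)" using ext_sign z xy0 by blast
    obtain b where b: "b \<in> {1, -1}" "p - q + d \<le> 2 * (b * y0)" using ext_sign2 z xy0 by blast
    let ?A = "adj_rel (leap q (2 * q - p)) ?S"
    have e1: "((x0 - a * q, y0 - b * q), (x0, y0 + b * (q - p))) \<in> ?A"
      "((x0, y0 + b * (q - p)), (x0 - a * q, y0 - b * q)) \<in> ?A"
      if "a \<in> {1, -1}" "b \<in> {1, -1}" "p - q + d \<le> 2 * (a * x0)" "p - q + d \<le> 2 * (b * y0)"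
        "\<bar>2 * x0\<bar> \<le> q - p - d" for a b
      using xy[of x0 y0 a b] y[of x0 y0 b] that z xy0 p pq by (auto simp: adj_rel_def leap_def)
    have e2: "((x0 - a * q, y0 - b * q), (x0 + a * (q - p), y0)) \<in> ?A"
      "((x0 + a * (q - p), y0), (x0 - a * q, y0 - b * q)) \<in> ?A"
      if "a \<in> {1, -1}" "b \<in> {1, -1}" "p - q + d \<le> 2 * (a * x0)" "p - q + d \<le> 2 * (b * y0)"
        "\<bar>2 * y0\<bar> \<le> q - p - d" for a b
      using xy[of x0 y0 a b] x[of x0 y0 a] that z xy0 p pq by (auto simp: adj_rel_def leap_def)
    let ?h = "(x0 - a * q, y0 - b * q)"
    have B: "((x0 - a * q, y0 - b' * q), ?h) \<in> ?A\<^sup>*"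
      if b': "b' \<in> {1, -1}" "p - q + d \<le> 2 * (b' * y0)" for b'
    proof (cases "b' = b")
      case False
      then have "\<bar>2 * y0\<bar> \<le> q - p - d" using mid_of_two_signs[OF b'(1) b(1) _ b'(2) b(2)] by simp
      then show ?thesis using e2(1)[OF a(1) b'(1) a(2) b'(2)] e2(2)[OF a(1) b(1) a(2) b(2)]
        by (meson converse_rtrancl_into_rtrancl rtrancl.rtrancl_refl)
    qed simp
    have AB: "((x0 - a' * q, y0 - b' * q), ?h) \<in> ?A\<^sup>*"
      if a': "a' \<in> {1, -1}" "p - q + d \<le> 2 * (a' * x0)" and b': "b' \<in> {1, -1}" "p - q + d \<le> 2 * (b' * y0)"
      for a' b'
    proof (cases "a' = a")
      case False
      then have m: "\<bar>2 * x0\<bar> \<le> q - p - d" using mid_of_two_signs[OF a'(1) a(1) _ a'(2) a(2)] by simp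
      show ?thesis
        using e1(1)[OF a'(1) b'(1) a'(2) b'(2) m] e1(2)[OF a(1) b'(1) a(2) b'(2) m] B[OF b']
        by (meson converse_rtrancl_into_rtrancl)
    qed (use B[OF b'] in simp)
    show "\<exists>h. rep_G p q d z h \<and> (\<forall>w. rep_G p q d z w \<longrightarrow> (w, h) \<in> ?A\<^sup>*)"
    proof (intro exI[of _ ?h] conjI allI impI)
      show "rep_G p q d z ?h" using rep_G.G_xy a b xy0 by blast
      fix w assume "rep_G p q d z w"
      then show "(w, ?h) \<in> ?A\<^sup>*"
      proof cases
        case (G_xy a' b' x y)
        then show ?thesis using AB[of a' b'] xy0 by simp
      next
        case (G_y b' y x)
        then have "(w, (x0 - a * q, y0 - b' * q)) \<in> ?A" using e1(2)[of a b'] a xy0 by simp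
        then show ?thesis using B[of b'] G_y xy0 by (simp add: converse_rtrancl_into_rtrancl)
      next
        case (G_x a' x y)
        then have "(w, (x0 - a' * q, y0 - b * q)) \<in> ?A" using e2(2)[of a' b] b xy0 by simp
        then show ?thesis using AB[of a' b] G_x b xy0 by (simp add: converse_rtrancl_into_rtrancl)
      qed
    qed
  next
    fix z z' assume zz': "(z, z') \<in> adj_rel (leap p q) S"
    show "\<exists>w w'. rep_G p q d z w \<and> rep_G p q d z' w' \<and> leap q (2 * q - p) w w'"
    proof (rule rep_edge[of G, unfolded rep.simps, OF _ zz'])
      fix x y a b
      assume h: "a \<in> {1, -1}" "b \<in> {1, -1}" "2 * (a * x) \<le> q - p - d"
        "q - p + d \<le> 2 * (b * y)" and S: "(x, y) \<in> S" "(x + a * p, y - b * q) \<in> S"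
      \<comment> \<open>These are corner representatives for opposite signs: \<open>- a\<close> and
        \<open>b\<close> for the first square, \<open>a\<close> and \<open>- b\<close> for its
        neighbour.\<close>
      let ?w = "(x + a * q, y - b * q)" and ?w' = "(x + a * p - a * q, y)"
      have "rep_G p q d (x, y) ?w"
        using rep_G.G_xy[of "- a" b p q d x y] h pq d by auto
      moreover have "rep_G p q d (x + a * p, y - b * q) ?w'"
        using rep_G.G_xy[of a "- b" p q d "x + a * p" "y - b * q"] h zone1[OF S(1)] zone2[OF S(1)] p pq d
        by auto
      moreover have "leap q (2 * q - p) ?w ?w'" using h(1,2) p pq by (auto simp: leap_def)
      ultimately show "\<exists>w w'. rep_G p q d (x, y) w \<and> rep_G p q d (x + a * p, y - b * q) w' \<and>
          leap q (2 * q - p) w w'" by blast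
    qed
  qed (simp add: lift_iff)
  show "?S \<noteq> {}"
  proof (rule lift_ne)
    fix x y assume S: "(x, y) \<in> S"
    obtain a where "a \<in> {1, -1}" "p - q + d \<le> 2 * (a * x)" using ext_sign S by blast
    moreover obtain b where "b \<in> {1, -1}" "p - q + d \<le> 2 * (b * y)" using ext_sign2 S by blast
    ultimately show "\<exists>w. rep G p q d (x, y) w" using rep_G.G_xy[of a b p q d x y] by auto
  qed
qed (use p pq d lift_swap lift_neg in auto)

end

context proper_shape begin

text \<open>By \<open>proper\<close>, every square has a coordinate in an outer range and therefore
  a representative. The outer sign of a coordinate is unique, so a cluster has at most three
  squares: either a single side representative, or a corner representative adjacent to two side
  representatives.\<close>

lemma proper_shape_lift_F: "proper_shape p (2 * p + q) d (lift F p q d S)"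
proof unfold_locales
  let ?S = "lift F p q d S"
  have xy: "(x + a * p, y + b * p) \<in> ?S"
    if "(x, y) \<in> S" "a \<in> {1, -1}" "b \<in> {1, -1}" "q - p + d \<le> 2 * (a * x)" "q - p + d \<le> 2 * (b * y)" for x y a b
    using liftI[of F, OF _ that(1)] rep_F.F_xy[OF that(2-5)] by simp
  have y: "(x, y - b * (p + q)) \<in> ?S"
    if "(x, y) \<in> S" "b \<in> {1, -1}" "q - p + d \<le> 2 * (b * y)" for x y b
    using liftI[of F, OF _ that(1)] rep_F.F_y[OF that(2-3)] by simp
  have x: "(x - a * (p + q), y) \<in> ?S"
    if "(x, y) \<in> S" "a \<in> {1, -1}" "q - p + d \<le> 2 * (a * x)" for x y a
    using liftI[of F, OF _ that(1)] rep_F.F_x[OF that(2-3)] by simp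
  have zones: "\<bar>2 * x'\<bar> \<le> p + (2 * p + q) - d \<and>
      (\<bar>2 * x'\<bar> \<le> 2 * p + q - p - d \<or> 2 * p + q - p + d \<le> \<bar>2 * x'\<bar>) \<and>
      (2 * p + q - p + d \<le> \<bar>2 * x'\<bar> \<or> 2 * p + q - p + d \<le> \<bar>2 * y'\<bar>)"
    if w: "(x', y') \<in> ?S" for x' y'
  proof -
    obtain z where z: "z \<in> S" "rep_F p q d z (x', y')" using w unfolding lift_iff rep.simps by blast
    from z(2) show ?thesis
    proof cases
      case (F_xy a b x y)
      then show ?thesis using zone1[of x y] z(1) p pq by auto
    next
      case (F_y b y)
      then show ?thesis using zone1[of x' y] zone2[of x' y] z(1) p pq d by auto
    next
      case (F_x a x)
      then show ?thesis using zone1[of x y'] zone2[of x y'] z(1) p pq d by auto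
    qed
  qed
  then show "\<bar>2 * x'\<bar> \<le> p + (2 * p + q) - d \<and>
      (\<bar>2 * x'\<bar> \<le> 2 * p + q - p - d \<or> 2 * p + q - p + d \<le> \<bar>2 * x'\<bar>)"
    and "2 * p + q - p + d \<le> \<bar>2 * x'\<bar> \<or> 2 * p + q - p + d \<le> \<bar>2 * y'\<bar>"
    if "(x', y') \<in> ?S" for x' y'
    using that by blast+
  show "(x' + a' * p, y' - b' * (2 * p + q)) \<in> ?S"
    if h: "(x', y') \<in> ?S" "a' \<in> {1, -1}" "b' \<in> {1, -1}"
      "2 * (a' * x') \<le> 2 * p + q - p - d" "2 * p + q - p + d \<le> 2 * (b' * y')" for x' y' a' b'
  proof -
    obtain z where z: "z \<in> S" "rep_F p q d z (x', y')" using h(1) unfolding lift_iff rep.simps by blast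
    from z(2) show ?thesis
    proof cases
      case (F_xy a b x y)
      have S: "(x, y) \<in> S" using z(1) F_xy by simp
      have ab: "b' = b" "a' = - a" using F_xy h(2-5) zone1[OF S] zone2[OF S] p pq d by auto
      have "x' + a' * p = x" "y' - b' * (2 * p + q) = y - b * (p + q)"
        using F_xy ab by (simp_all add: algebra_simps)
      then show ?thesis using y[OF S F_xy(5) F_xy(7)] by simp
    next
      case (F_y b y)
      have S: "(x', y) \<in> S" using z(1) F_y by simp
      have b': "b' = - b" using F_y h(2-5) zone2[OF S] p pq d by auto
      have y': "y' - b' * (2 * p + q) = y + b * p" using F_y b' by (simp add: algebra_simps)
      show ?thesis
      proof (cases "q - p + d \<le> 2 * (a' * x')")
        case True
        then show ?thesis using xy[OF S h(2) F_y(3) True F_y(4)] unfolding y' by simp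
      next
        case False
        \<comment> \<open>Without a corner representative towards \<open>a'\<close>, the target is
          the side representative of the old neighbour
          \<open>(x' + a' * p, y - b * q)\<close>.\<close>
        then have "2 * (a' * x') \<le> q - p - d" using zone1[OF S] h(2) pq by auto
        then have S': "(x' + a' * p, y - b * q) \<in> S" by (rule step[OF S h(2) F_y(3) _ F_y(4)])
        have "q - p + d \<le> 2 * (- b * (y - b * q))" using F_y(3) zone2[OF S] by auto
        then have "(x' + a' * p, y - b * q - - b * (p + q)) \<in> ?S"
          by (rule y[OF S' sign_uminus[OF F_y(3)]])
        moreover have "y - b * q - - b * (p + q) = y + b * p" by (simp add: algebra_simps)
        ultimately show ?thesis by (simp only: y')
      qed
    next
      case (F_x a x)
      then show ?thesis using h(2-5) zone2[of x y'] z(1) p pq d by auto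
    qed
  qed
  show "connected_in (leap p (2 * p + q)) ?S"
  proof (rule connected_lift[OF con symp_leap, where R = "rep_F p q d"])
    fix z assume z: "z \<in> S"
    obtain x0 y0 where xy0: "z = (x0, y0)" by (cases z)
    let ?A = "adj_rel (leap p (2 * p + q)) ?S"
    have sign: "a = a'" if "a \<in> {1, -1}" "a' \<in> {1, -1}" "q - p + d \<le> 2 * (a * u)" "q - p + d \<le> 2 * (a' * u)"
      for a a' u :: int using that pq d by auto
    have e1: "((x0, y0 - b * (p + q)), (x0 + a * p, y0 + b * p)) \<in> ?A"
      "((x0 - a * (p + q), y0), (x0 + a * p, y0 + b * p)) \<in> ?A"
      if "a \<in> {1, -1}" "b \<in> {1, -1}" "q - p + d \<le> 2 * (a * x0)" "q - p + d \<le> 2 * (b * y0)" for a b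
      using xy[of x0 y0 a b] y[of x0 y0 b] x[of x0 y0 a] that z xy0 p pq
      by (auto simp: adj_rel_def leap_def)
    show "\<exists>h. rep_F p q d z h \<and> (\<forall>w. rep_F p q d z w \<longrightarrow> (w, h) \<in> ?A\<^sup>*)"
    proof -
      have "\<exists>a\<in>{1, -1}. q - p + d \<le> 2 * (a * x0)" if "q - p + d \<le> \<bar>2 * x0\<bar>"
        using that by (cases "x0 < 0") auto
      moreover have "\<exists>b\<in>{1, -1}. q - p + d \<le> 2 * (b * y0)" if "q - p + d \<le> \<bar>2 * y0\<bar>"
        using that by (cases "y0 < 0") auto
      ultimately consider (both) a b where "a \<in> {1, -1}" "b \<in> {1, -1}" "q - p + d \<le> 2 * (a * x0)"
          "q - p + d \<le> 2 * (b * y0)"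
        | (y) b where "b \<in> {1, -1}" "q - p + d \<le> 2 * (b * y0)" "\<not> q - p + d \<le> \<bar>2 * x0\<bar>"
        | (x) a where "a \<in> {1, -1}" "q - p + d \<le> 2 * (a * x0)" "\<not> q - p + d \<le> \<bar>2 * y0\<bar>"
        using proper[of x0 y0] z xy0 by blast
      then show ?thesis
      proof cases
        case both
        let ?h = "(x0 + a * p, y0 + b * p)"
        show ?thesis
        proof (intro exI[of _ ?h] conjI allI impI)
          show "rep_F p q d z ?h" using rep_F.F_xy both xy0 by blast
          fix w assume "rep_F p q d z w"
          then show "(w, ?h) \<in> ?A\<^sup>*"
          proof cases
            case (F_xy a' b' x y)
            then have "w = ?h" using both sign[of a a' x0] sign[of b b' y0] xy0 by simp
            then show ?thesis by simp
          next
            case (F_y b' y x)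
            then have "b' = b" using both sign[of b b' y0] xy0 by simp
            then show ?thesis using e1(1)[OF both] F_y xy0 by (simp add: r_into_rtrancl)
          next
            case (F_x a' x y)
            then have "a' = a" using both sign[of a a' x0] xy0 by simp
            then show ?thesis using e1(2)[OF both] F_x xy0 by (simp add: r_into_rtrancl)
          qed
        qed
      next
        case y
        let ?h = "(x0, y0 - b * (p + q))"
        show ?thesis
        proof (intro exI[of _ ?h] conjI allI impI)
          show "rep_F p q d z ?h" using rep_F.F_y y xy0 by blast
          fix w assume "rep_F p q d z w"
          then show "(w, ?h) \<in> ?A\<^sup>*"
          proof cases
            case (F_y b' y' x)
            then have "b' = b" using y sign[of b b' y0] xy0 by simp
            then show ?thesis using F_y xy0 by simp
          qed (use y xy0 in auto)
        qed
      next
        case x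
        let ?h = "(x0 - a * (p + q), y0)"
        show ?thesis
        proof (intro exI[of _ ?h] conjI allI impI)
          show "rep_F p q d z ?h" using rep_F.F_x x xy0 by blast
          fix w assume "rep_F p q d z w"
          then show "(w, ?h) \<in> ?A\<^sup>*"
          proof cases
            case (F_x a' x' y)
            then have "a' = a" using x sign[of a a' x0] xy0 by simp
            then show ?thesis using F_x xy0 by simp
          qed (use x xy0 in auto)
        qed
      qed
    qed
  next
    fix z z' assume zz': "(z, z') \<in> adj_rel (leap p q) S"
    show "\<exists>w w'. rep_F p q d z w \<and> rep_F p q d z' w' \<and> leap p (2 * p + q) w w'"
    proof (rule rep_edge[of F, unfolded rep.simps, OF _ zz'])
      fix x y a b
      assume h: "a \<in> {1, -1}" "b \<in> {1, -1}" "2 * (a * x) \<le> q - p - d"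
        "q - p + d \<le> 2 * (b * y)" and S: "(x, y) \<in> S" "(x + a * p, y - b * q) \<in> S"
      let ?w = "(x, y - b * (p + q))" and ?w' = "(x + a * p, y - b * q - - b * (p + q))"
      have "rep_F p q d (x, y) ?w" using rep_F.F_y h by blast
      moreover have "q - p + d \<le> 2 * (- b * (y - b * q))" using h(2) zone2[OF S(1)] by auto
      then have "rep_F p q d (x + a * p, y - b * q) ?w'"
        by (rule rep_F.F_y[OF sign_uminus[OF h(2)]])
      moreover have "leap p (2 * p + q) ?w ?w'" using h(1,2) p pq by (auto simp: leap_def)
      ultimately show "\<exists>w w'. rep_F p q d (x, y) w \<and> rep_F p q d (x + a * p, y - b * q) w' \<and>
          leap p (2 * p + q) w w'" by blast
    qed
  qed (simp add: lift_iff)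
  show "?S \<noteq> {}"
  proof (rule lift_ne)
    fix x y assume S: "(x, y) \<in> S"
    from proper[OF S] show "\<exists>w. rep F p q d (x, y) w"
    proof
      assume "q - p + d \<le> \<bar>2 * x\<bar>"
      then have "\<exists>a\<in>{1, -1}. q - p + d \<le> 2 * (a * x)" by (cases "x < 0") auto
      then show ?thesis unfolding rep.simps by (blast intro: rep_F.F_x)
    next
      assume "q - p + d \<le> \<bar>2 * y\<bar>"
      then have "\<exists>b\<in>{1, -1}. q - p + d \<le> 2 * (b * y)" by (cases "y < 0") auto
      then show ?thesis unfolding rep.simps by (blast intro: rep_F.F_y)
    qed
  qed
qed (use p pq d lift_swap lift_neg in auto)

end

section \<open>Tours\<close>

definition rot :: "square \<Rightarrow> square" where "rot = (\<lambda>(x, y). (- y, x))"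
definition flip :: "square \<Rightarrow> square" where "flip = (\<lambda>(x, y). (- x, y))"
definition rot_inv :: "square \<Rightarrow> square" where "rot_inv = (\<lambda>(x, y). (y, - x))"

lemma leap_isometries:
  "leap m n (rot a) (rot b) \<longleftrightarrow> leap m n a b"
  "leap m n (rot_inv a) (rot_inv b) \<longleftrightarrow> leap m n a b"
  "leap m n (flip a) (flip b) \<longleftrightarrow> leap m n a b"
  by (auto simp: leap_def rot_def rot_inv_def flip_def split: prod.splits)

lemma successively_map_leap:
  assumes "\<And>a b. leap m n (f a) (f b) \<longleftrightarrow> leap m n a b"
  shows "successively (leap m n) (map f xs) \<longleftrightarrow> successively (leap m n) xs"
  by (simp add: successively_map assms)

text \<open>\<open>gs\<close> is the arc in the corner \<open>x, y > 0\<close>, run from the right side to the top, and \<open>ts\<close> is the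
  adjacent arc on the top side. The equation for \<open>hd ts\<close> is the condition, invariant under all
  three lifts, that makes the rearranged arcs fit together.\<close>

locale tour = proper_shape +
  fixes m n :: int and gs ts :: "square list"
  assumes m: "0 \<le> m" and mn: "d = n - m"
    and set_gs: "set gs = {(x, y). (x, y) \<in> S \<and> q - p + d \<le> 2 * x \<and> q - p + d \<le> 2 * y}"
    and set_ts: "set ts = {(x, y). (x, y) \<in> S \<and> \<bar>2 * x\<bar> \<le> q - p - d \<and> q - p + d \<le> 2 * y}"
    and ne_lists: "gs \<noteq> []" "ts \<noteq> []"
    and distinct: "distinct gs" "distinct ts"
    and rev_gs: "rev gs = map prod.swap gs" and rev_ts: "rev ts = map flip ts"
    and succ: "successively (leap m n) gs" "successively (leap m n) ts"
    and hd_ts: "hd ts = (snd (last gs) - p, q - fst (last gs))"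
    and link: "leap m n (last gs) (hd ts)"
begin

text \<open>The order is counterclockwise: \<open>arc5\<close> runs through the right side, a
  corner, the top, a corner and the left side; \<open>arc3\<close> is its part around the first
  corner, \<open>arc3'\<close> its part along the top border. Together with \<open>gs\<close> and
  \<open>ts\<close>, these are the stretches that are copied into the lifted shapes.\<close>

definition "arc3 = map rot_inv ts @ gs @ ts"
definition "arc3' = gs @ ts @ map rot gs"
definition "arc5 = map rot_inv ts @ gs @ ts @ map rot gs @ map rot ts"

lemma hd_gs: "hd gs = prod.swap (last gs)"
proof -
  have "last gs = hd (rev gs)" using ne_lists by (simp add: hd_rev)
  then show ?thesis using rev_gs ne_lists by (simp add: hd_map)
qed

lemma last_ts: "last ts = flip (hd ts)"
proof -
  have "last ts = hd (rev ts)" using ne_lists by (simp add: hd_rev)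
  then show ?thesis using rev_ts ne_lists by (simp add: hd_map)
qed

text \<open>The symmetries of the square carry the junction \<open>link\<close> to the other three
  junctions; the ends match because a reflection reverses each of \<open>gs\<close> and
  \<open>ts\<close>.\<close>

lemma successively_arc5: "successively (leap m n) arc5"
proof -
  have 1: "leap m n (last (map rot_inv ts)) (hd gs)"
    using link leap_swap[of m n "last gs" "hd ts"] ne_lists
    by (simp add: last_map last_ts hd_gs rot_inv_def flip_def prod.swap_def case_prod_unfold leap_commute)
  have 2: "leap m n (last ts) (hd (map rot gs))"
    using link leap_isometries(3)[of m n "last gs" "hd ts"] ne_lists
    by (simp add: hd_map last_ts hd_gs rot_def flip_def prod.swap_def case_prod_unfold leap_commute)
  have 3: "leap m n (last (map rot gs)) (hd (map rot ts))"
    using link ne_lists by (simp add: hd_map last_map leap_isometries)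
  show ?thesis
    using 1 2 3 succ link ne_lists
    by (simp add: arc5_def successively_append_iff successively_map_leap leap_isometries)
qed

lemma successively_arc3: "successively (leap m n) arc3"
  and successively_arc3': "successively (leap m n) arc3'"
  using successively_arc5 by (simp_all add: arc5_def arc3_def arc3'_def successively_append_iff hd_append ne_lists)

lemma neg2: "(x, y) \<in> S \<Longrightarrow> (x, - y) \<in> S"
  using swap neg by blast

lemma set_map_rot: "set (map rot xs) = {(x, y). (y, - x) \<in> set xs}"
  by (force simp: rot_def)

lemma set_map_rot_inv: "set (map rot_inv xs) = {(x, y). (- y, x) \<in> set xs}"
  by (force simp: rot_inv_def)

lemma S_simps: "(y, - x) \<in> S \<longleftrightarrow> (x, y) \<in> S" "(- y, x) \<in> S \<longleftrightarrow> (x, y) \<in> S"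
proof -
  show "(y, - x) \<in> S \<longleftrightarrow> (x, y) \<in> S"
  proof
    assume "(y, - x) \<in> S"
    from neg[OF swap[OF this]] show "(x, y) \<in> S" by simp
  qed (blast intro: neg2 swap)
  show "(- y, x) \<in> S \<longleftrightarrow> (x, y) \<in> S"
  proof
    assume "(- y, x) \<in> S"
    from swap[OF neg[OF this]] show "(x, y) \<in> S" by simp
  qed (blast intro: neg swap)
qed

text \<open>The inequalities are those that the lifts impose on the old square, with signs 1:
  \<open>arc3\<close> belongs to \<open>G_xy\<close> and \<open>H_xy\<close>, \<open>arc3'\<close>
  to \<open>F_y\<close>, and \<open>arc5\<close> to \<open>H_y\<close>.\<close>

lemma set_arcs:
  "set arc3 = {(x, y). (x, y) \<in> S \<and> p - q + d \<le> 2 * x \<and> p - q + d \<le> 2 * y}"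
  "set arc3' = {(x, y). (x, y) \<in> S \<and> q - p + d \<le> 2 * y}"
  "set arc5 = {(x, y). (x, y) \<in> S \<and> p - q + d \<le> 2 * y}"
proof -
  have z: "(x, y) \<in> S \<Longrightarrow> (\<bar>2 * x\<bar> \<le> q - p - d \<or> q - p + d \<le> \<bar>2 * x\<bar>) \<and>
      (\<bar>2 * y\<bar> \<le> q - p - d \<or> q - p + d \<le> \<bar>2 * y\<bar>) \<and> (q - p + d \<le> \<bar>2 * x\<bar> \<or> q - p + d \<le> \<bar>2 * y\<bar>)" for x y
    using zone1 zone2 proper by blast
  have "(x, y) \<in> set arc3 \<longleftrightarrow> (x, y) \<in> S \<and> p - q + d \<le> 2 * x \<and> p - q + d \<le> 2 * y" for x y
    unfolding arc3_def set_append set_map_rot_inv set_gs set_ts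
    using pq d z[of x y] by (auto simp: S_simps)
  then show "set arc3 = {(x, y). (x, y) \<in> S \<and> p - q + d \<le> 2 * x \<and> p - q + d \<le> 2 * y}" by auto
  have "(x, y) \<in> set arc3' \<longleftrightarrow> (x, y) \<in> S \<and> q - p + d \<le> 2 * y" for x y
    unfolding arc3'_def set_append set_map_rot set_gs set_ts
    using pq d z[of x y] by (auto simp: S_simps)
  then show "set arc3' = {(x, y). (x, y) \<in> S \<and> q - p + d \<le> 2 * y}" by auto
  have "(x, y) \<in> set arc5 \<longleftrightarrow> (x, y) \<in> S \<and> p - q + d \<le> 2 * y" for x y
    unfolding arc5_def set_append set_map_rot set_map_rot_inv set_gs set_ts
    using pq d z[of x y] by (auto simp: S_simps)
  then show "set arc5 = {(x, y). (x, y) \<in> S \<and> p - q + d \<le> 2 * y}" by auto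
qed

lemma inj_rot: "inj rot" "inj rot_inv"
  by (auto simp: inj_def rot_def rot_inv_def)

lemma distinct_arc5: "distinct arc5"
proof -
  have "distinct (map rot gs)" "distinct (map rot ts)" "distinct (map rot_inv ts)"
    using distinct by (simp_all add: distinct_map inj_on_subset[OF inj_rot(1)] inj_on_subset[OF inj_rot(2)])
  then show ?thesis
    unfolding arc5_def distinct_append set_append set_map_rot set_map_rot_inv set_gs set_ts
    using pq d distinct by auto
qed

lemma distinct_arc3: "distinct arc3" and distinct_arc3': "distinct arc3'"
  using distinct_arc5 by (auto simp: arc5_def arc3_def arc3'_def)

lemma rev_arcs:
  "rev arc3 = map prod.swap arc3" "rev arc3' = map flip arc3'" "rev arc5 = map flip arc5"
proof -
  have *: "rev (map rot ts) = map flip (map rot_inv ts)" "rev (map rot_inv ts) = map flip (map rot ts)"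
    "rev (map rot gs) = map flip gs" "rev (map rot_inv ts) = map prod.swap ts"
    "rev ts = map prod.swap (map rot_inv ts)" "rev gs = map flip (map rot gs)"
    unfolding rev_map rev_ts rev_gs
    by (auto simp: rot_def rot_inv_def flip_def split: prod.splits)
  show "rev arc3 = map prod.swap arc3" by (simp add: arc3_def *(4,5) rev_gs del: map_map rev_map)
  show "rev arc3' = map flip arc3'" by (simp add: arc3'_def *(3,6) rev_ts del: map_map rev_map)
  show "rev arc5 = map flip arc5" by (simp add: arc5_def *(1,2,3,6) rev_ts del: map_map rev_map)
qed

lemma hd_last_arcs:
  "hd arc3 = rot_inv (hd ts)" "last arc3 = last ts" "hd arc3' = hd gs" "hd arc5 = rot_inv (hd ts)"
  "arc3 \<noteq> []" "arc3' \<noteq> []" "arc5 \<noteq> []"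
  using ne_lists by (simp_all add: arc3_def arc3'_def arc5_def hd_append hd_map)

end

section \<open>Tours of the lifted shapes\<close>

lemma leap_maps:
  "leap m n (fst a + s, snd a + t) (fst b + s, snd b + t) \<longleftrightarrow> leap m n a b"
  "leap m n (fst a, s - snd a) (fst b, s - snd b) \<longleftrightarrow> leap m n a b"
  "leap m n (s - snd a, s - fst a) (s - snd b, s - fst b) \<longleftrightarrow> leap m n a b"
  "leap m n (fst a, snd a + t) (fst b, snd b + t) \<longleftrightarrow> leap m n a b"
  by (auto simp: leap_def abs_minus_commute)

lemma set_maps:
  "set (map (\<lambda>z. (fst z + s, snd z + t)) xs) = {(x, y). (x - s, y - t) \<in> set xs}"
  "set (map (\<lambda>z. (fst z, c - snd z)) xs) = {(x, y). (x, c - y) \<in> set xs}"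
  "set (map (\<lambda>z. (c - snd z, c - fst z)) xs) = {(x, y). (c - y, c - x) \<in> set xs}"
  "set (map (\<lambda>z. (fst z, snd z + c)) xs) = {(x, y). (x, y - c) \<in> set xs}"
  for s t c :: int
  by (force simp: image_iff)+

lemma distinct_maps:
  "distinct (map (\<lambda>z. (fst z + s, snd z + t)) xs) \<longleftrightarrow> distinct xs"
  "distinct (map (\<lambda>z. (fst z, c - snd z)) xs) \<longleftrightarrow> distinct xs"
  "distinct (map (\<lambda>z. (c - snd z, c - fst z)) xs) \<longleftrightarrow> distinct xs"
  "distinct (map (\<lambda>z. (fst z, snd z + c)) xs) \<longleftrightarrow> distinct xs"
  for s t c :: int
  by (auto simp: distinct_map inj_on_def prod_eq_iff)

lemma rev_maps:
  "rev xs = map prod.swap xs \<Longrightarrow>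
    rev (map (\<lambda>z. (fst z + c, snd z + c)) xs) = map prod.swap (map (\<lambda>z. (fst z + c, snd z + c)) xs)"
  "rev xs = map prod.swap xs \<Longrightarrow>
    rev (map (\<lambda>z. (c - snd z, c - fst z)) xs) = map prod.swap (map (\<lambda>z. (c - snd z, c - fst z)) xs)"
  "rev xs = map flip xs \<Longrightarrow> rev (map (\<lambda>z. (fst z, c - snd z)) xs) = map flip (map (\<lambda>z. (fst z, c - snd z)) xs)"
  "rev xs = map flip xs \<Longrightarrow> rev (map (\<lambda>z. (fst z, snd z + c)) xs) = map flip (map (\<lambda>z. (fst z, snd z + c)) xs)"
  for c :: int
  by (auto simp: flip_def prod.swap_def case_prod_unfold rev_map)

context tour begin

lemma hd_ts': "fst (hd ts) = snd (last gs) - p" "snd (hd ts) = q - fst (last gs)"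
  using hd_ts by simp_all

text \<open>The new corner arises from \<open>F_xy\<close> with both signs 1, which shifts the old
  corner. The new top arises from \<open>F_y\<close> with \<open>b = -1\<close>, that is, from the
  bottom border; by symmetry of the old shape, it is \<open>arc3'\<close> reflected in a horizontal
  line. By \<open>hd_ts\<close>, the leap at the new junction is the same vector as at the old
  one.\<close>

lemma tour_lift_F:
  "tour p (2 * p + q) d (lift F p q d S) m n
    (map (\<lambda>z. (fst z + p, snd z + p)) gs) (map (\<lambda>z. (fst z, p + q - snd z)) arc3')"
proof (intro tour.intro proper_shape_lift_F tour_axioms.intro m mn)
  let ?S = "lift F p q d S"
  have z: "(x, y) \<in> S \<Longrightarrow> \<bar>2 * x\<bar> \<le> p + q - d \<and> \<bar>2 * y\<bar> \<le> p + q - d" for x y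
    using zone1 zone2 by blast
  have "(x', y') \<in> ?S \<and> 2 * p + q - p + d \<le> 2 * x' \<and> 2 * p + q - p + d \<le> 2 * y' \<longleftrightarrow>
      (x' - p, y' - p) \<in> S \<and> q - p + d \<le> 2 * (x' - p) \<and> q - p + d \<le> 2 * (y' - p)"
    (is "?l \<longleftrightarrow> ?r") for x' y'
  proof
    assume l: ?l
    then obtain u where u: "u \<in> S" "rep_F p q d u (x', y')" unfolding lift_iff rep.simps by blast
    from u(2) show ?r
    proof cases
      case (F_xy a b x y)
      have "a = 1" "b = 1" using F_xy l u(1) z[of x y] p pq d by auto
      then show ?thesis using F_xy u(1) l by auto
    next
      case (F_y b y)
      then show ?thesis using l u(1) z[of x' y] d by auto
    next
      case (F_x a x)
      then show ?thesis using l u(1) z[of x y'] d by auto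
    qed
  next
    assume r: ?r
    then have "rep_F p q d (x' - p, y' - p) (x' - p + 1 * p, y' - p + 1 * p)"
      by (intro rep_F.F_xy) auto
    then show ?l using r liftI[of F p q d "(x' - p, y' - p)"] by auto
  qed
  then show "set (map (\<lambda>z. (fst z + p, snd z + p)) gs) =
      {(x, y). (x, y) \<in> ?S \<and> 2 * p + q - p + d \<le> 2 * x \<and> 2 * p + q - p + d \<le> 2 * y}"
    unfolding set_maps set_gs by auto
  have "(x', y') \<in> ?S \<and> \<bar>2 * x'\<bar> \<le> 2 * p + q - p - d \<and> 2 * p + q - p + d \<le> 2 * y' \<longleftrightarrow>
      (x', p + q - y') \<in> S \<and> q - p + d \<le> 2 * (p + q - y')"
    (is "?l \<longleftrightarrow> ?r") for x' y'
  proof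
    assume l: ?l
    then obtain u where u: "u \<in> S" "rep_F p q d u (x', y')" unfolding lift_iff rep.simps by blast
    from u(2) show ?r
    proof cases
      case (F_xy a b x y)
      then show ?thesis using l u(1) z[of x y] p pq d by auto
    next
      case (F_y b y)
      have "b = -1" using F_y l u(1) z[of x' y] p pq d by auto
      moreover have "(x', - y) \<in> S" using F_y u(1) neg2 by simp
      ultimately show ?thesis using F_y by (auto simp: algebra_simps)
    next
      case (F_x a x)
      then show ?thesis using l u(1) z[of x y'] d by auto
    qed
  next
    assume r: ?r
    have S: "(x', y' - (p + q)) \<in> S" using neg2[of x' "p + q - y'"] r by simp
    have "rep_F p q d (x', y' - (p + q)) (x', y' - (p + q) - (- 1) * (p + q))"
      using r by (intro rep_F.F_y) auto
    then show ?l using r S liftI[of F p q d "(x', y' - (p + q))" _ S] z[OF S] by auto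
  qed
  then show "set (map (\<lambda>z. (fst z, p + q - snd z)) arc3') =
      {(x, y). (x, y) \<in> ?S \<and> \<bar>2 * x\<bar> \<le> 2 * p + q - p - d \<and> 2 * p + q - p + d \<le> 2 * y}"
    unfolding set_maps set_arcs by auto
  show "successively (leap m n) (map (\<lambda>z. (fst z + p, snd z + p)) gs)"
    "successively (leap m n) (map (\<lambda>z. (fst z, p + q - snd z)) arc3')"
    using succ successively_arc3' by (simp_all add: successively_map_leap leap_maps)
  show "leap m n (last (map (\<lambda>z. (fst z + p, snd z + p)) gs)) (hd (map (\<lambda>z. (fst z, p + q - snd z)) arc3'))"
    using link ne_lists hd_ts'
    by (simp add: last_map hd_map hd_last_arcs hd_gs leap_def algebra_simps)
qed (use ne_lists hd_last_arcs distinct distinct_arc3' rev_maps rev_gs rev_arcs hd_gs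
    in \<open>simp_all add: distinct_maps hd_map last_map\<close>)

text \<open>The new corner arises from \<open>G_xy\<close> with both signs -1; by symmetry of the
  old shape, it is the image of \<open>arc3\<close> in an antidiagonal line. The new top arises from
  \<open>G_y\<close> with \<open>b = 1\<close>, which shifts \<open>ts\<close>. The leap at the new
  junction is again the old vector.\<close>

lemma tour_lift_G:
  "tour q (2 * q - p) d (lift G p q d S) m n
    (map (\<lambda>z. (q - snd z, q - fst z)) arc3) (map (\<lambda>z. (fst z, snd z + (q - p))) ts)"
proof (intro tour.intro proper_shape_lift_G tour_axioms.intro m mn)
  let ?S = "lift G p q d S"
  have z: "(x, y) \<in> S \<Longrightarrow> \<bar>2 * x\<bar> \<le> p + q - d \<and> \<bar>2 * y\<bar> \<le> p + q - d" for x y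
    using zone1 zone2 by blast
  have "(x', y') \<in> ?S \<and> 2 * q - p - q + d \<le> 2 * x' \<and> 2 * q - p - q + d \<le> 2 * y' \<longleftrightarrow>
      (q - y', q - x') \<in> S \<and> p - q + d \<le> 2 * (q - y') \<and> p - q + d \<le> 2 * (q - x')"
    (is "?l \<longleftrightarrow> ?r") for x' y'
  proof
    assume l: ?l
    then obtain u where u: "u \<in> S" "rep_G p q d u (x', y')" unfolding lift_iff rep.simps by blast
    from u(2) show ?r
    proof cases
      case (G_xy a b x y)
      have "a = -1" "b = -1" using G_xy l u(1) z[of x y] p pq d by auto
      moreover have "(- y, - x) \<in> S" using G_xy u(1) neg neg2 swap by blast
      ultimately show ?thesis using G_xy by auto
    next
      case (G_y b y)
      then show ?thesis using l d by auto
    next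
      case (G_x a x)
      then show ?thesis using l d by auto
    qed
  next
    assume r: ?r
    then have S: "(x' - q, y' - q) \<in> S" using swap neg[of "q - y'"] neg2[of "- (q - y')" "q - x'"] by auto
    have "rep_G p q d (x' - q, y' - q) (x' - q - (- 1) * q, y' - q - (- 1) * q)"
      using r by (intro rep_G.G_xy) auto
    then show ?l using r S liftI[of G p q d "(x' - q, y' - q)" _ S] z[OF S] by auto
  qed
  then show "set (map (\<lambda>z. (q - snd z, q - fst z)) arc3) =
      {(x, y). (x, y) \<in> ?S \<and> 2 * q - p - q + d \<le> 2 * x \<and> 2 * q - p - q + d \<le> 2 * y}"
    unfolding set_maps set_arcs by auto
  have "(x', y') \<in> ?S \<and> \<bar>2 * x'\<bar> \<le> 2 * q - p - q - d \<and> 2 * q - p - q + d \<le> 2 * y' \<longleftrightarrow>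
      (x', y' - (q - p)) \<in> S \<and> \<bar>2 * x'\<bar> \<le> q - p - d \<and> q - p + d \<le> 2 * (y' - (q - p))"
    (is "?l \<longleftrightarrow> ?r") for x' y'
  proof
    assume l: ?l
    then obtain u where u: "u \<in> S" "rep_G p q d u (x', y')" unfolding lift_iff rep.simps by blast
    from u(2) show ?r
    proof cases
      case (G_xy a b x y)
      then show ?thesis using l u(1) z[of x y] p pq d by auto
    next
      case (G_y b y)
      have "(x', y) \<in> S" using G_y u(1) by simp
      have "b = 1" using G_y l pq d by auto
      \<comment> \<open>As \<open>x'\<close> is in the middle range, \<open>proper\<close> puts
        \<open>y\<close> in an outer range; this must be the one of sign 1, as \<open>G_y\<close>
        excludes the opposite one.\<close>
      then show ?thesis using G_y u(1) proper[of x' y] d by auto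
    next
      case (G_x a x)
      then show ?thesis using l d by auto
    qed
  next
    assume r: ?r
    then have "rep_G p q d (x', y' - (q - p)) (x', y' - (q - p) + 1 * (q - p))"
      using pq by (intro rep_G.G_y) auto
    then show ?l using r pq liftI[of G p q d "(x', y' - (q - p))" _ S] by auto
  qed
  then show "set (map (\<lambda>z. (fst z, snd z + (q - p))) ts) =
      {(x, y). (x, y) \<in> ?S \<and> \<bar>2 * x\<bar> \<le> 2 * q - p - q - d \<and> 2 * q - p - q + d \<le> 2 * y}"
    unfolding set_maps set_ts by auto
  show "successively (leap m n) (map (\<lambda>z. (q - snd z, q - fst z)) arc3)"
    "successively (leap m n) (map (\<lambda>z. (fst z, snd z + (q - p))) ts)"
    using succ successively_arc3 by (simp_all add: successively_map_leap leap_maps)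
  show "leap m n (last (map (\<lambda>z. (q - snd z, q - fst z)) arc3)) (hd (map (\<lambda>z. (fst z, snd z + (q - p))) ts))"
    using link ne_lists
    by (simp add: last_map hd_map hd_last_arcs last_ts flip_def case_prod_unfold leap_def hd_ts) arith
  show "hd (map (\<lambda>z. (fst z, snd z + (q - p))) ts) =
      (snd (last (map (\<lambda>z. (q - snd z, q - fst z)) arc3)) - q,
       2 * q - p - fst (last (map (\<lambda>z. (q - snd z, q - fst z)) arc3)))"
    using ne_lists by (simp add: last_map hd_map hd_last_arcs last_ts flip_def case_prod_unfold)
qed (use ne_lists hd_last_arcs distinct distinct_arc3 rev_maps rev_ts rev_arcs
    in \<open>simp_all add: distinct_maps\<close>)

text \<open>The new corner arises from \<open>H_xy\<close> with both signs 1, which shifts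
  \<open>arc3\<close>. The new top arises from \<open>H_y\<close> with \<open>b = -1\<close> and is,
  by symmetry, \<open>arc5\<close> reflected in a horizontal line. At the new junction the old
  vector recurs with one coordinate negated.\<close>

lemma tour_lift_H:
  "tour q (p + 2 * q) d (lift H p q d S) m n
    (map (\<lambda>z. (fst z + q, snd z + q)) arc3) (map (\<lambda>z. (fst z, p + q - snd z)) arc5)"
proof (intro tour.intro proper_shape_lift_H tour_axioms.intro m mn)
  let ?S = "lift H p q d S"
  have z: "(x, y) \<in> S \<Longrightarrow> \<bar>2 * x\<bar> \<le> p + q - d \<and> \<bar>2 * y\<bar> \<le> p + q - d" for x y
    using zone1 zone2 by blast
  have "(x', y') \<in> ?S \<and> p + 2 * q - q + d \<le> 2 * x' \<and> p + 2 * q - q + d \<le> 2 * y' \<longleftrightarrow>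
      (x' - q, y' - q) \<in> S \<and> p - q + d \<le> 2 * (x' - q) \<and> p - q + d \<le> 2 * (y' - q)"
    (is "?l \<longleftrightarrow> ?r") for x' y'
  proof
    assume l: ?l
    then obtain u where u: "u \<in> S" "rep_H p q d u (x', y')" unfolding lift_iff rep.simps by blast
    from u(2) show ?r
    proof cases
      case (H_xy a b x y)
      have "a = 1" "b = 1" using H_xy l u(1) z[of x y] p pq d by auto
      then show ?thesis using H_xy u(1) by auto
    next
      case (H_y b y)
      then show ?thesis using l u(1) z[of x' y] d by auto
    next
      case (H_x a x)
      then show ?thesis using l u(1) z[of x y'] d by auto
    qed
  next
    assume r: ?r
    then have "rep_H p q d (x' - q, y' - q) (x' - q + 1 * q, y' - q + 1 * q)"
      by (intro rep_H.H_xy) auto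
    then show ?l using r liftI[of H p q d "(x' - q, y' - q)" _ S] by auto
  qed
  then show "set (map (\<lambda>z. (fst z + q, snd z + q)) arc3) =
      {(x, y). (x, y) \<in> ?S \<and> p + 2 * q - q + d \<le> 2 * x \<and> p + 2 * q - q + d \<le> 2 * y}"
    unfolding set_maps set_arcs by auto
  have "(x', y') \<in> ?S \<and> \<bar>2 * x'\<bar> \<le> p + 2 * q - q - d \<and> p + 2 * q - q + d \<le> 2 * y' \<longleftrightarrow>
      (x', p + q - y') \<in> S \<and> p - q + d \<le> 2 * (p + q - y')"
    (is "?l \<longleftrightarrow> ?r") for x' y'
  proof
    assume l: ?l
    then obtain u where u: "u \<in> S" "rep_H p q d u (x', y')" unfolding lift_iff rep.simps by blast
    from u(2) show ?r
    proof cases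
      case (H_xy a b x y)
      then show ?thesis using l u(1) z[of x y] p pq d by auto
    next
      case (H_y b y)
      have "b = -1" using H_y l u(1) z[of x' y] p pq d by auto
      moreover have "(x', - y) \<in> S" using H_y u(1) neg2 by simp
      ultimately show ?thesis using H_y by (auto simp: algebra_simps)
    next
      case (H_x a x)
      then show ?thesis using l u(1) z[of x y'] d by auto
    qed
  next
    assume r: ?r
    have S: "(x', y' - (p + q)) \<in> S" using neg2[of x' "p + q - y'"] r by simp
    have "rep_H p q d (x', y' - (p + q)) (x', y' - (p + q) - (- 1) * (p + q))"
      using r by (intro rep_H.H_y) auto
    then show ?l using r S liftI[of H p q d "(x', y' - (p + q))" _ S] z[OF S] by auto
  qed
  then show "set (map (\<lambda>z. (fst z, p + q - snd z)) arc5) =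
      {(x, y). (x, y) \<in> ?S \<and> \<bar>2 * x\<bar> \<le> p + 2 * q - q - d \<and> p + 2 * q - q + d \<le> 2 * y}"
    unfolding set_maps set_arcs by auto
  show "successively (leap m n) (map (\<lambda>z. (fst z + q, snd z + q)) arc3)"
    "successively (leap m n) (map (\<lambda>z. (fst z, p + q - snd z)) arc5)"
    using successively_arc3 successively_arc5 by (simp_all add: successively_map_leap leap_maps)
  show "leap m n (last (map (\<lambda>z. (fst z + q, snd z + q)) arc3)) (hd (map (\<lambda>z. (fst z, p + q - snd z)) arc5))"
    using link
    by (simp add: last_map hd_map hd_last_arcs last_ts flip_def rot_inv_def case_prod_unfold leap_def hd_ts) arith
  show "hd (map (\<lambda>z. (fst z, p + q - snd z)) arc5) =
      (snd (last (map (\<lambda>z. (fst z + q, snd z + q)) arc3)) - q,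
       p + 2 * q - fst (last (map (\<lambda>z. (fst z + q, snd z + q)) arc3)))"
    by (simp add: last_map hd_map hd_last_arcs last_ts flip_def rot_inv_def case_prod_unfold)
qed (use hd_last_arcs distinct_arc3 distinct_arc5 rev_maps rev_arcs
    in \<open>simp_all add: distinct_maps\<close>)

end

section \<open>Lifts of the origin, and tours of translates\<close>

text \<open>With slack \<open>q - p\<close> the middle range shrinks to 0. The translates of this
  shape are the isolated squares of the board.\<close>

lemma shape_origin:
  assumes "0 \<le> p" "p < q" shows "shape p q (q - p) {(0, 0)}"
  by unfold_locales (use assms in \<open>auto simp: connected_in_def\<close>)

lemma lift_origin_G:
  assumes "0 \<le> p" "p < q"
  shows "lift G p q (q - p) {(0, 0)} = {(q, q), (q, - q), (- q, q), (- q, - q),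
    (0, q - p), (0, p - q), (q - p, 0), (p - q, 0)}"
  (is "?l = ?r")
proof
  show "?l \<subseteq> ?r"
  proof
    fix w assume "w \<in> ?l"
    then have "rep_G p q (q - p) (0, 0) w" by (simp add: lift_iff)
    then show "w \<in> ?r" by cases (elim insertE emptyE; simp)+
  qed
  have xy: "(- (a * q), - (b * q)) \<in> ?l" if "a \<in> {1, -1}" "b \<in> {1, -1}" for a b
    using rep_G.G_xy[of a b p q "q - p" 0 0] that assms by (simp add: lift_iff)
  have y: "(0, b * (q - p)) \<in> ?l" if "b \<in> {1, -1}" for b
    using rep_G.G_y[of b p q "q - p" 0 0] that assms by (simp add: lift_iff)
  have x: "(a * (q - p), 0) \<in> ?l" if "a \<in> {1, -1}" for a
    using rep_G.G_x[of a p q "q - p" 0 0] that assms by (simp add: lift_iff)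
  show "?r \<subseteq> ?l"
    using xy[of 1 1] xy[of 1 "-1"] xy[of "-1" 1] xy[of "-1" "-1"] y[of 1] y[of "-1"] x[of 1] x[of "-1"]
    by (simp add: algebra_simps)
qed

lemma lift_origin_H:
  assumes "0 \<le> p" "p < q"
  shows "lift H p q (q - p) {(0, 0)} = {(q, q), (q, - q), (- q, q), (- q, - q),
    (0, p + q), (0, - p - q), (p + q, 0), (- p - q, 0)}"
  (is "?l = ?r")
proof
  show "?l \<subseteq> ?r"
  proof
    fix w assume "w \<in> ?l"
    then have "rep_H p q (q - p) (0, 0) w" by (simp add: lift_iff)
    then show "w \<in> ?r" by cases (elim insertE emptyE; simp)+
  qed
  have xy: "(a * q, b * q) \<in> ?l" if "a \<in> {1, -1}" "b \<in> {1, -1}" for a b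
    using rep_H.H_xy[of a b p q "q - p" 0 0] that assms by (simp add: lift_iff)
  have y: "(0, - (b * (p + q))) \<in> ?l" if "b \<in> {1, -1}" for b
    using rep_H.H_y[of b p q "q - p" 0 0] that assms by (simp add: lift_iff)
  have x: "(- (a * (p + q)), 0) \<in> ?l" if "a \<in> {1, -1}" for a
    using rep_H.H_x[of a p q "q - p" 0 0] that assms by (simp add: lift_iff)
  show "?r \<subseteq> ?l"
    using xy[of 1 1] xy[of 1 "-1"] xy[of "-1" 1] xy[of "-1" "-1"] y[of 1] y[of "-1"] x[of 1] x[of "-1"]
    by (simp add: algebra_simps)
qed

text \<open>Corner squares and side squares alternate, and consecutive ones differ by
  \<open>q\<close> in one coordinate and \<open>p\<close> in the other; thus the old leaper tours
  the new shape, with one square in each arc.\<close>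

lemma tour_origin_G:
  assumes "0 \<le> p" "p < q"
  shows "tour q (2 * q - p) (q - p) (lift G p q (q - p) {(0, 0)}) p q [(q, q)] [(0, q - p)]"
  by (intro tour.intro shape.proper_shape_lift_G shape_origin tour_axioms.intro)
    (use assms in \<open>auto simp: lift_origin_G flip_def leap_def\<close>)

lemma tour_origin_H:
  assumes "0 \<le> p" "p < q"
  shows "tour q (p + 2 * q) (q - p) (lift H p q (q - p) {(0, 0)}) p q [(q, q)] [(0, p + q)]"
  by (intro tour.intro shape.proper_shape_lift_H shape_origin tour_axioms.intro)
    (use assms in \<open>auto simp: lift_origin_H flip_def leap_def\<close>)

section \<open>The closed tour of a shape, and its translates\<close>

context tour begin

text \<open>Negation turns the run along the top border, corners included, into a run along the
  bottom border in the same sense of rotation; this is the stretch that \<open>arc5\<close>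
  omits.\<close>

definition "cyc = arc5 @ map uminus arc3'"

lemma set_cyc: "set cyc = S"
proof -
  have "(x, y) \<in> set (map uminus arc3') \<longleftrightarrow> (- x, - y) \<in> S \<and> q - p + d \<le> 2 * (- y)" for x y
  proof -
    have "set (map uminus arc3') = {(x, y). (- x, - y) \<in> set arc3'}" by (force simp: uminus_prod_def)
    then show ?thesis by (simp add: set_arcs)
  qed
  moreover have "(- x, - y) \<in> S \<longleftrightarrow> (x, y) \<in> S" for x y
    using neg[of x y] neg2[of "- x" y] neg[of "- x" "- y"] neg2[of x "- y"] by (simp, blast)
  ultimately have "(x, y) \<in> set cyc \<longleftrightarrow> (x, y) \<in> S" for x y
    using zone2[of x y] pq d by (auto simp: cyc_def set_arcs)
  then show ?thesis by auto
qed

lemma distinct_cyc: "distinct cyc"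
  using distinct_arc5 distinct_arc3' d pq by (auto simp: cyc_def set_arcs distinct_map inj_on_def)

lemma length_cyc: "length cyc = 4 * (length gs + length ts)"
  by (simp add: cyc_def arc5_def arc3'_def)

lemma successively_cyc: "successively (leap m n) (cyc @ [hd cyc])"
proof -
  have um: "leap m n (- a) (- b) \<longleftrightarrow> leap m n a b" for a b
    by (auto simp: leap_def abs_minus_commute)
  have "last arc5 = rot (flip (hd ts))" "last arc3' = rot (last gs)"
    using ne_lists by (simp_all add: arc5_def arc3'_def last_map last_ts)
  \<comment> \<open>Both closing junctions are images of \<open>link\<close> under symmetries of the
    square.\<close>
  then have "leap m n (last arc5) (- hd arc3')" "leap m n (- last arc3') (hd arc5)"
    using link by (simp_all add: hd_last_arcs hd_gs leap_def rot_def flip_def rot_inv_def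
        case_prod_unfold) arith+
  then show ?thesis
    using hd_last_arcs(5-7) successively_arc5 successively_arc3'
    by (simp add: cyc_def successively_append_iff successively_map_leap um hd_append hd_map last_map)
qed

lemma cyc_adj: "i < length cyc \<Longrightarrow> leap m n (cyc ! i) (cyc ! (Suc i mod length cyc))"
proof -
  assume i: "i < length cyc"
  have "leap m n ((cyc @ [hd cyc]) ! i) ((cyc @ [hd cyc]) ! Suc i)"
    using successively_cyc i unfolding successively_conv_nth by simp
  moreover have "(cyc @ [hd cyc]) ! Suc i = cyc ! (Suc i mod length cyc)"
  proof (cases "Suc i = length cyc")
    case True
    then have "cyc \<noteq> []" by force
    then show ?thesis using True by (simp add: nth_append hd_conv_nth)
  qed (use i in \<open>simp add: nth_append\<close>)
  ultimately show ?thesis using i by (simp add: nth_append)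
qed

lemma finite_S: "finite S" and card_S: "card S = 4 * (length gs + length ts)"
  using set_cyc distinct_cyc length_cyc by (metis finite_set, metis distinct_card)

lemma length_cyc_ge: "3 \<le> length cyc"
proof -
  have "0 < length gs" using ne_lists by simp
  then show ?thesis unfolding length_cyc by arith
qed

end

lemma leap_translate: "leap m n (v + a) (v + b) \<longleftrightarrow> leap m n a b"
  by (simp add: leap_def)

lemma leaper_move_iff_leap: "leaper_move p q a b \<longleftrightarrow> leap (int p) (int q) a b"
proof -
  obtain x y u v where "a = (x, y)" "b = (u, v)" by (cases a, cases b)
  then show ?thesis
    by (auto simp: leaper_move_def leap_def abs_if algebra_simps split: if_splits)
qed

lemma leaper_graph_induced: "leaper_graph p q B = induced (leap (int p) (int q)) B"
  by (simp add: leaper_graph_def induced_def leaper_move_iff_leap)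

lemma translate_induced: "translate v (induced (leap p q) B) = induced (leap p q) ((+) v ` B)"
proof -
  have "(`) ((+) v) ` {{a, b} | a b. a \<in> B \<and> b \<in> B \<and> leap p q a b} =
      {{a, b} | a b. a \<in> (+) v ` B \<and> b \<in> (+) v ` B \<and> leap p q a b}" (is "?l = ?r")
  proof
    show "?l \<subseteq> ?r"
    proof
      fix e assume "e \<in> ?l"
      then obtain a b where "e = {v + a, v + b}" "a \<in> B" "b \<in> B" "leap p q a b" by auto
      then have "e = {v + a, v + b}" "v + a \<in> (+) v ` B" "v + b \<in> (+) v ` B" "leap p q (v + a) (v + b)"
        by (simp_all add: leap_translate)
      then show "e \<in> ?r" by blast
    qed
    show "?r \<subseteq> ?l"
    proof
      fix e assume "e \<in> ?r"
      then obtain a b where "e = {v + a, v + b}" "a \<in> B" "b \<in> B" "leap p q a b"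
        by (auto simp: leap_translate)
      then have "e = (+) v ` {a, b}" "{a, b} \<in> {{a, b} | a b. a \<in> B \<and> b \<in> B \<and> leap p q a b}"
        by (simp, blast)
      then show "e \<in> ?l" by blast
    qed
  qed
  then show ?thesis by (simp add: translate_def induced_def)
qed

lemma (in tour) hamiltonian_translate: "hamiltonian (induced (leap m n) ((+) v ` S))"
proof -
  let ?c = "map ((+) v) cyc"
  have "is_cycle (cycle_through ?c)"
    using distinct_cyc length_cyc_ge by (auto simp: is_cycle_def distinct_map intro!: exI[of _ ?c])
  moreover have set: "set ?c = (+) v ` S" by (simp add: set_cyc)
  have "{?c ! i, ?c ! (Suc i mod length ?c)} \<in> edges (induced (leap m n) ((+) v ` S))"
    if i: "i < length ?c" for i
  proof -
    have lt: "Suc i mod length ?c < length ?c" using i by (intro mod_less_divisor) linarith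
    then have "?c ! i \<in> (+) v ` S" "?c ! (Suc i mod length ?c) \<in> (+) v ` S"
      using i lt set nth_mem by blast+
    moreover have "leap m n (?c ! i) (?c ! (Suc i mod length ?c))"
      using cyc_adj[of i] i lt by (simp add: leap_translate)
    ultimately show ?thesis unfolding induced_def ugraph.sel by blast
  qed
  then have "subgraph_of (cycle_through ?c) (induced (leap m n) ((+) v ` S))"
    using set by (auto simp: subgraph_of_def cycle_through_def induced_def)
  ultimately show ?thesis
    unfolding hamiltonian_def cycles_of_def using set
    by (intro bexI[of _ "cycle_through ?c"]) (simp_all add: cycle_through_def induced_def)
qed

section \<open>The family of cycles of a descent\<close>

lemma gh_suffixes_Nil: "gh_suffixes [] = []"
  by (simp add: gh_suffixes_def)

text \<open>A new first character shifts the old positions by one and adds position 1, whose suffix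
  is \<open>e\<close>.\<close>

lemma gh_suffixes_Cons: "gh_suffixes (c # e) = (if c = F then [] else [e]) @ gh_suffixes e"
proof -
  have "[1..<Suc (Suc (length e))] = 1 # map Suc [1..<Suc (length e)]"
    by (simp only: map_Suc_upt) (simp add: upt_rec)
  moreover have "filter (\<lambda>j. (c # e) ! j \<in> {G, H}) [1..<Suc (length e)] =
      filter (\<lambda>j. e ! (j - 1) \<in> {G, H}) [1..<Suc (length e)]"
    by (intro filter_cong) (auto simp: nth_Cons')
  ultimately show ?thesis
    by (cases c) (simp_all add: gh_suffixes_def filter_map o_def)
qed

text \<open>Since \<open>(1, 2)\<close> is the image of \<open>(0, 1)\<close> under the operation \<open>H\<close>, the wazir \<open>(0, 1)\<close> of the last
  type plays the same role as the leapers of the suffixes.\<close>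

definition touring :: "op_type list \<Rightarrow> (nat \<times> nat) list" where
  "touring e = map (\<lambda>s. foldr apply_op s (1, 2)) (gh_suffixes e) @ [(0, 1)]"

lemma touring_simps:
  "touring [] = [(0, 1)]"
  "touring (c # e) = (if c = F then [] else [foldr apply_op e (1, 2)]) @ touring e"
  by (simp_all add: touring_def gh_suffixes_Nil gh_suffixes_Cons)

text \<open>An entry \<open>((m, n), S, g, t)\<close> records the touring leaper, the shape, and the lengths of a
  corner arc and of a side arc.\<close>

type_synonym entry = "(nat \<times> nat) \<times> square set \<times> nat \<times> nat"

fun tourable :: "int \<Rightarrow> int \<Rightarrow> entry \<Rightarrow> bool" where
  "tourable p q ((m, n), S, g, t) \<longleftrightarrow>
    (\<exists>gs ts. tour p q (int n - int m) S (int m) (int n) gs ts \<and> length gs = g \<and> length ts = t)"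

lemma tourableI:
  "tour p q (int n - int m) S (int m) (int n) gs ts \<Longrightarrow> tourable p q ((m, n), S, length gs, length ts)"
  by auto

text \<open>The lengths are read off the tours of the lifted shapes: \<open>arc3'\<close> has length
  \<open>2 * g + t\<close>, \<open>arc3\<close> has \<open>g + 2 * t\<close>, and
  \<open>arc5\<close> has \<open>2 * g + 3 * t\<close>. The touring leaper does not change.\<close>

fun lift_entry :: "op_type \<Rightarrow> int \<Rightarrow> int \<Rightarrow> entry \<Rightarrow> entry" where
  "lift_entry F p q ((m, n), S, g, t) = ((m, n), lift F p q (int n - int m) S, g, 2 * g + t)"
| "lift_entry G p q ((m, n), S, g, t) = ((m, n), lift G p q (int n - int m) S, g + 2 * t, t)"
| "lift_entry H p q ((m, n), S, g, t) = ((m, n), lift H p q (int n - int m) S, g + 2 * t, 2 * g + 3 * t)"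

text \<open>The sizes increase strictly along the family, which distinguishes the types.\<close>

fun smaller :: "entry \<Rightarrow> entry \<Rightarrow> bool" where
  "smaller (_, _, g, t) (_, _, g', t') \<longleftrightarrow> g \<le> g' \<and> t \<le> t' \<and> g + t < g' + t'"

text \<open>The squares of one of the four corners, and below of one of the four sides, counted over
  all translates of the shape; the number of translates is the square of the slack
  \<open>n - m\<close>.\<close>

fun corners :: "entry \<Rightarrow> int" where "corners ((m, n), _, g, _) = (int n - int m)\<^sup>2 * int g"
fun sides :: "entry \<Rightarrow> int" where "sides ((m, n), _, _, t) = (int n - int m)\<^sup>2 * int t"

lemma lift_entry_simps:
  "fst (lift_entry c p q y) = fst y"
  "corners (lift_entry F p q y) = corners y"
  "sides (lift_entry F p q y) = 2 * corners y + sides y"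
  "corners (lift_entry G p q y) = corners y + 2 * sides y"
  "sides (lift_entry G p q y) = sides y"
  "corners (lift_entry H p q y) = corners y + 2 * sides y"
  "sides (lift_entry H p q y) = 2 * corners y + 3 * sides y"
proof -
  obtain m n S g t where y: "y = ((m, n), S, g, t)" by (cases y rule: corners.cases)
  show "fst (lift_entry c p q y) = fst y" by (cases c) (simp_all add: y)
qed (cases y rule: corners.cases; simp add: algebra_simps)+

lemma smaller_lift: "smaller y y' \<Longrightarrow> smaller (lift_entry c p q y) (lift_entry c p q y')"
  by (cases y rule: corners.cases; cases y' rule: corners.cases; cases c) auto

lemma tourable_pos: "tourable p q (mn, S, g, t) \<Longrightarrow> 0 < g \<and> 0 < t"
  by (cases mn) (auto simp: tour_def tour_axioms_def)

lemma tourable_lift: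
  assumes "tourable p q y"
  shows "tourable p (2 * p + q) (lift_entry F p q y)"
    "tourable q (2 * q - p) (lift_entry G p q y)"
    "tourable q (p + 2 * q) (lift_entry H p q y)"
proof -
  obtain m n S g t where y: "y = ((m, n), S, g, t)" by (cases y rule: corners.cases)
  then obtain gs ts where t: "tour p q (int n - int m) S (int m) (int n) gs ts"
    and len: "length gs = g" "length ts = t" using assms by auto
  note arcs = tour.arc3_def[OF t] tour.arc3'_def[OF t] tour.arc5_def[OF t]
  show "tourable p (2 * p + q) (lift_entry F p q y)"
    using tour.tour_lift_F[OF t] len by (auto simp: y arcs intro!: exI)
  show "tourable q (2 * q - p) (lift_entry G p q y)"
    using tour.tour_lift_G[OF t] len by (auto simp: y arcs intro!: exI)
  show "tourable q (p + 2 * q) (lift_entry H p q y)"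
    using tour.tour_lift_H[OF t] len by (auto simp: y arcs intro!: exI)
qed

text \<open>The two totals are the sizes of a corner block, \<open>p\<close> by \<open>p\<close>,
  and of a side block, \<open>p\<close> by \<open>q - p\<close>, of the border of the board. Lifting
  acts on them linearly, and the new type created by \<open>G\<close> or \<open>H\<close> adds the
  square of \<open>q - p\<close> to each.\<close>

definition family :: "nat \<Rightarrow> nat \<Rightarrow> (nat \<times> nat) list \<Rightarrow> entry list \<Rightarrow> bool" where
  "family p q ms ys \<longleftrightarrow> map fst ys = ms \<and> (\<forall>y\<in>set ys. tourable (int p) (int q) y) \<and>
    sorted_wrt smaller ys \<and> sum_list (map corners ys) = (int p)\<^sup>2 \<and>
    sum_list (map sides ys) = int p * (int q - int p)"

lemma sum_list_lift_entry:
  "sum_list (map corners (map (lift_entry F p q) ys)) = sum_list (map corners ys)"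
  "sum_list (map sides (map (lift_entry F p q) ys)) =
    2 * sum_list (map corners ys) + sum_list (map sides ys)"
  "sum_list (map corners (map (lift_entry G p q) ys)) =
    sum_list (map corners ys) + 2 * sum_list (map sides ys)"
  "sum_list (map sides (map (lift_entry G p q) ys)) = sum_list (map sides ys)"
  "sum_list (map corners (map (lift_entry H p q) ys)) =
    sum_list (map corners ys) + 2 * sum_list (map sides ys)"
  "sum_list (map sides (map (lift_entry H p q) ys)) =
    2 * sum_list (map corners ys) + 3 * sum_list (map sides ys)"
  by (induction ys) (simp_all add: lift_entry_simps)

lemma sorted_lift: "sorted_wrt smaller ys \<Longrightarrow> sorted_wrt smaller (map (lift_entry c p q) ys)"
  unfolding sorted_wrt_map by (rule sorted_wrt_mono_rel) (auto intro: smaller_lift)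

text \<open>A lifted corner arc has length \<open>g + 2 * t\<close>, which is at least 3, so the new
  cycle of length eight may be put in front of the sorted list.\<close>

lemma smaller_new:
  assumes "c \<noteq> F" "tourable p q y" shows "smaller (mn, S, 1, 1) (lift_entry c p q y)"
proof -
  obtain m n S' g t where y: "y = ((m, n), S', g, t)" by (cases y rule: corners.cases)
  then have "0 < g \<and> 0 < t" using tourable_pos assms(2) by blast
  then show ?thesis using assms(1) by (cases c) (auto simp: y)
qed

text \<open>On the 3 by 3 board the shape is the ring of eight squares around the centre, which is
  the lift of the origin under \<open>H\<close> from \<open>(0, 1)\<close>.\<close>

lemma family_Nil: "\<exists>ys. family 1 2 (touring []) ys"
proof -
  let ?y = "((0, 1), lift H 0 1 1 {(0, 0)}, 1, 1) :: entry"
  have "tourable 1 2 ?y"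
    using tourableI[of 1 2 1 0 "lift H 0 1 1 {(0, 0)}" "[(1, 1)]" "[(0, 1)]"] tour_origin_H[of 0 1] by simp
  then have "family 1 2 (touring []) [?y]" by (simp add: family_def touring_simps)
  then show ?thesis ..
qed

lemma family_Cons:
  assumes fam: "family p q ms ys" and pq: "0 < p" "p < q" and c: "apply_op c (p, q) = (p', q')"
  shows "\<exists>ys'. family p' q' ((if c = F then [] else [(p, q)]) @ ms) ys'"
proof -
  have ms: "map fst ys = ms" and t: "\<And>y. y \<in> set ys \<Longrightarrow> tourable p q y"
    and sorted: "sorted_wrt smaller ys"
    and sums: "sum_list (map corners ys) = (int p)\<^sup>2" "sum_list (map sides ys) = int p * (int q - int p)"
    using fam by (auto simp: family_def)
  let ?l = "map (lift_entry c p q) ys"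
  have l: "map fst ?l = ms" "sorted_wrt smaller ?l"
    using ms sorted sorted_lift by (auto simp: lift_entry_simps cong: map_cong)
  show ?thesis
  proof (cases c)
    case F
    then have pq': "p' = p" "q' = 2 * p + q" using c by auto
    have "family p' q' ms ?l"
      unfolding family_def using l t tourable_lift(1) sums
      by (auto simp: F pq' sum_list_lift_entry power2_eq_square algebra_simps simp del: map_map)
    then show ?thesis using F by auto
  next
    case G
    then have pq': "p' = q" "q' = 2 * q - p" using c by auto
    let ?y = "((p, q), lift G p q (int q - int p) {(0, 0)}, 1, 1) :: entry"
    have "tour q (2 * int q - int p) (int q - int p) (lift G p q (int q - int p) {(0, 0)}) p q
        [(int q, int q)] [(0, int q - int p)]"
      using tour_origin_G[of "int p" "int q"] pq by simp
    then have new: "tourable p' q' ?y"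
      using tourableI[of _ _ q p _ "[(int q, int q)]" "[(0, int q - int p)]"] pq
      by (simp add: pq' of_nat_diff)
    have "tourable p' q' (lift_entry c p q y)" if "y \<in> set ys" for y
      using tourable_lift(2)[OF t[OF that]] pq by (simp add: G pq' of_nat_diff)
    moreover have "smaller ?y (lift_entry c p q y)" if "y \<in> set ys" for y
      using smaller_new[OF _ t[OF that]] G by blast
    ultimately have "family p' q' ((p, q) # ms) (?y # ?l)"
      unfolding family_def using l new sums pq
      by (auto simp: G pq' of_nat_diff sum_list_lift_entry power2_eq_square algebra_simps simp del: map_map)
    then show ?thesis using G by auto
  next
    case H
    then have pq': "p' = q" "q' = p + 2 * q" using c by auto
    let ?y = "((p, q), lift H p q (int q - int p) {(0, 0)}, 1, 1) :: entry"
    have "tour q (int p + 2 * int q) (int q - int p) (lift H p q (int q - int p) {(0, 0)}) p q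
        [(int q, int q)] [(0, int p + int q)]"
      using tour_origin_H[of "int p" "int q"] pq by simp
    then have new: "tourable p' q' ?y"
      using tourableI[of _ _ q p _ "[(int q, int q)]" "[(0, int p + int q)]"] by (simp add: pq')
    have "tourable p' q' (lift_entry c p q y)" if "y \<in> set ys" for y
      using tourable_lift(3)[OF t[OF that]] by (simp add: H pq')
    moreover have "smaller ?y (lift_entry c p q y)" if "y \<in> set ys" for y
      using smaller_new[OF _ t[OF that]] H by blast
    ultimately have "family p' q' ((p, q) # ms) (?y # ?l)"
      unfolding family_def using l new sums pq
      by (auto simp: H pq' sum_list_lift_entry power2_eq_square algebra_simps simp del: map_map)
    then show ?thesis using H by auto
  qed
qed

lemma ex_family: "is_descent e p q \<Longrightarrow> \<exists>ys. family p q (touring e) ys"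
proof (induction e arbitrary: p q)
  case Nil
  then show ?case using family_Nil by (simp add: is_descent_def)
next
  case (Cons c e)
  obtain m n where mn: "foldr apply_op e (1, 2) = (m, n)" by fastforce
  then have e: "is_descent e m n" by (simp add: is_descent_def)
  then obtain ys where "family m n (touring e) ys" using Cons.IH by blast
  moreover have "0 < m" "m < n" using is_descent_basic[OF e] by auto
  moreover have "apply_op c (m, n) = (p, q)" using Cons.prems mn by (simp add: is_descent_def)
  ultimately show ?case using family_Cons[of m n] unfolding touring_simps mn by blast
qed

section \<open>The board\<close>

lemma leap_iff:
  assumes "0 \<le> p" "0 \<le> q"
  shows "leap p q (x, y) (u, v) \<longleftrightarrow>
    (u = x + p \<or> u = x - p) \<and> (v = y + q \<or> v = y - q) \<or>
    (u = x + q \<or> u = x - q) \<and> (v = y + p \<or> v = y - p)"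
proof -
  have *: "\<bar>u - x\<bar> = c \<longleftrightarrow> u = x + c \<or> u = x - c" if "0 \<le> c" for u x c :: int
    using that by arith
  show ?thesis by (simp add: leap_def * assms)
qed

lemma mem_square_board: "(x, y) \<in> square_board n \<longleftrightarrow> 0 \<le> x \<and> x < int n \<and> 0 \<le> y \<and> y < int n"
  by (auto simp: square_board_def)

text \<open>Cutting both coordinates at \<open>p\<close> and \<open>q\<close> gives nine blocks. On
  each of them at most two of the candidate moves stay on the board, and these are named
  explicitly.\<close>

lemma board_degree:
  assumes "p < q" "z \<in> square_board (p + q)"
  shows "card {w \<in> square_board (p + q). leap p q z w} \<le> 2"
proof -
  obtain x y where z: "z = (x, y)" by (cases z)
  have xy: "0 \<le> x" "x < int p + int q" "0 \<le> y" "y < int p + int q"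
    using assms(2) by (auto simp: z mem_square_board)
  define P Q where "P = int p" and "Q = int q"
  have PQ: "0 \<le> P" "P < Q" using assms(1) by (auto simp: P_def Q_def)
  have nbr: "(u, v) \<in> {w \<in> square_board (p + q). leap p q z w} \<Longrightarrow>
      0 \<le> u \<and> u < P + Q \<and> 0 \<le> v \<and> v < P + Q \<and>
      ((u = x + P \<or> u = x - P) \<and> (v = y + Q \<or> v = y - Q) \<or>
       (u = x + Q \<or> u = x - Q) \<and> (v = y + P \<or> v = y - P))" for u v
    by (simp add: z mem_square_board leap_iff P_def Q_def)
  have two: ?thesis if "\<And>u v. (u, v) \<in> {w \<in> square_board (p + q). leap p q z w} \<Longrightarrow> (u, v) \<in> {a, b}" for a b
  proof -
    have "{w \<in> square_board (p + q). leap p q z w} \<subseteq> {a, b}" using that by auto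
    then have "card {w \<in> square_board (p + q). leap p q z w} \<le> card {a, b}"
      by (intro card_mono) auto
    also have "\<dots> \<le> 2" by (simp add: card_insert_if)
    finally show ?thesis .
  qed
  consider "x < P" | "P \<le> x" "x < Q" | "Q \<le> x" by linarith
  then show ?thesis
  proof cases
    case x: 1
    consider "y < P" | "P \<le> y" "y < Q" | "Q \<le> y" by linarith
    then show ?thesis
    proof cases
      case 1
      show ?thesis by (rule two[of "(x + P, y + Q)" "(x + Q, y + P)"]; drule nbr; use x 1 PQ xy in auto)
    next
      case 2
      show ?thesis by (rule two[of "(x + Q, y + P)" "(x + Q, y - P)"]; drule nbr; use x 2 PQ xy in auto)
    next
      case 3
      show ?thesis by (rule two[of "(x + P, y - Q)" "(x + Q, y - P)"]; drule nbr; use x 3 PQ xy P_def Q_def in auto)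
    qed
  next
    case x: 2
    consider "y < P" | "P \<le> y" "y < Q" | "Q \<le> y" by linarith
    then show ?thesis
    proof cases
      case 1
      show ?thesis by (rule two[of "(x + P, y + Q)" "(x - P, y + Q)"]; drule nbr; use x 1 PQ xy in auto)
    next
      case 2
      \<comment> \<open>No move from the central block stays on the board, so any pair
        serves.\<close>
      show ?thesis by (rule two[of "(x, y)" "(x, y)"]; drule nbr; use x 2 PQ xy in auto)
    next
      case 3
      show ?thesis by (rule two[of "(x + P, y - Q)" "(x - P, y - Q)"]; drule nbr; use x 3 PQ xy P_def Q_def in auto)
    qed
  next
    case x: 3
    consider "y < P" | "P \<le> y" "y < Q" | "Q \<le> y" by linarith
    then show ?thesis
    proof cases
      case 1
      show ?thesis by (rule two[of "(x - P, y + Q)" "(x - Q, y + P)"]; drule nbr; use x 1 PQ xy P_def Q_def in auto)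
    next
      case 2
      show ?thesis by (rule two[of "(x - Q, y + P)" "(x - Q, y - P)"]; drule nbr; use x 2 PQ xy P_def Q_def in auto)
    next
      case 3
      show ?thesis by (rule two[of "(x - P, y - Q)" "(x - Q, y - P)"]; drule nbr; use x 3 PQ xy P_def Q_def in auto)
    qed
  qed
qed

text \<open>Every leap changes one coordinate by \<open>q\<close>, for which a coordinate from
  \<open>p\<close> to \<open>q - 1\<close> has no room in either direction.\<close>

lemma board_center_isolated:
  assumes "z \<in> {int p..<int q} \<times> {int p..<int q}" "w \<in> square_board (p + q)"
  shows "\<not> leap p q z w"
  using assms by (cases z; cases w) (auto simp: mem_square_board leap_iff)

lemma isolated_induced:
  assumes "symp adj"
  shows "isolated (induced adj V) v \<longleftrightarrow> v \<in> V \<and> (\<forall>w\<in>V. \<not> adj v w)"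
proof -
  have "(\<forall>e\<in>edges (induced adj V). v \<notin> e) \<longleftrightarrow> (\<forall>a\<in>V. \<forall>b\<in>V. adj a b \<longrightarrow> v \<noteq> a \<and> v \<noteq> b)"
    unfolding induced_def ugraph.sel by blast
  then show ?thesis using sympD[OF assms] by (auto simp: isolated_def induced_def)
qed

text \<open>From a corner square there is one leap of each orientation, and these differ as
  \<open>p < q\<close>. From a side square there are two leaps that shift by \<open>p\<close> in
  opposite senses, and these differ as \<open>0 < p\<close>.\<close>

lemma (in proper_shape) degree_ge_2:
  assumes "0 < p" "finite S" "z \<in> S" shows "2 \<le> card {w \<in> S. leap p q z w}"
proof -
  obtain x y where z: "z = (x, y)" by (cases z)
  then have S: "(x, y) \<in> S" using assms(3) by simp
  have two: ?thesis if "a \<in> S" "b \<in> S" "leap p q z a" "leap p q z b" "a \<noteq> b" for a b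
  proof -
    have "card {a, b} \<le> card {w \<in> S. leap p q z w}"
      using that assms(2) by (intro card_mono) auto
    then show ?thesis using that(5) by simp
  qed
  have sx: "\<exists>a\<in>{1, -1}. q - p + d \<le> 2 * (a * u)" if "q - p + d \<le> \<bar>2 * u\<bar>" for u
    using that by (cases "u < 0") auto
  consider (xy) "q - p + d \<le> \<bar>2 * x\<bar>" "q - p + d \<le> \<bar>2 * y\<bar>"
    | (y) "\<bar>2 * x\<bar> \<le> q - p - d" "q - p + d \<le> \<bar>2 * y\<bar>"
    | (x) "q - p + d \<le> \<bar>2 * x\<bar>" "\<bar>2 * y\<bar> \<le> q - p - d"
    using proper[OF S] zone1[OF S] zone2[OF S] by blast
  then show ?thesis
  proof cases
    case xy
    then obtain a b where ab: "a \<in> {1, -1}" "q - p + d \<le> 2 * (a * x)" "b \<in> {1, -1}" "q - p + d \<le> 2 * (b * y)"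
      using sx by blast
    have "2 * (- a * x) \<le> q - p - d" "2 * (- b * y) \<le> q - p - d" using ab pq by auto
    then have "(x + - a * p, y - b * q) \<in> S" "(x - a * q, y + - b * p) \<in> S"
      using step[OF S sign_uminus[OF ab(1)] ab(3) _ ab(4)] step_swap[OF S ab(1) sign_uminus[OF ab(3)] _ ab(2)]
      by blast+
    then show ?thesis by (rule two) (use ab pq p in \<open>auto simp: z leap_def\<close>)
  next
    case y
    then obtain b where b: "b \<in> {1, -1}" "q - p + d \<le> 2 * (b * y)" using sx by blast
    have "(x + 1 * p, y - b * q) \<in> S" "(x + - 1 * p, y - b * q) \<in> S"
      using step[OF S _ b(1) _ b(2), of 1] step[OF S _ b(1) _ b(2), of "-1"] y(1) by auto
    then show ?thesis by (rule two) (use b pq assms(1) in \<open>auto simp: z leap_def\<close>)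
  next
    case x
    then obtain a where a: "a \<in> {1, -1}" "q - p + d \<le> 2 * (a * x)" using sx by blast
    have "(x - a * q, y + 1 * p) \<in> S" "(x - a * q, y + - 1 * p) \<in> S"
      using step_swap[OF S a(1) _ _ a(2), of 1] step_swap[OF S a(1) _ _ a(2), of "-1"] x(2) by auto
    then show ?thesis by (rule two) (use a pq assms(1) in \<open>auto simp: z leap_def\<close>)
  qed
qed

section \<open>Translation copies\<close>

lemma degree_translate:
  "card {w \<in> (+) v ` S. leap p q (v + z) w} = card {w \<in> S. leap p q z w}"
proof -
  have "{w \<in> (+) v ` S. leap p q (v + z) w} = (+) v ` {w \<in> S. leap p q z w}"
    by (auto simp: leap_translate)
  then show ?thesis by (simp add: card_image)
qed

lemma connected_in_translate:
  assumes "connected_in (leap p q) S" shows "connected_in (leap p q) ((+) v ` S)"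
proof -
  have "(v + a, v + b) \<in> (adj_rel (leap p q) ((+) v ` S))\<^sup>*" if "(a, b) \<in> (adj_rel (leap p q) S)\<^sup>*" for a b
    using that
  proof (induction rule: rtrancl_induct)
    case (step b c)
    then have "(v + b, v + c) \<in> adj_rel (leap p q) ((+) v ` S)"
      by (simp add: adj_rel_def leap_translate)
    with step.IH show ?case by (rule rtrancl_into_rtrancl)
  qed simp
  then show ?thesis using assms by (simp add: connected_in_def)
qed

text \<open>Translation by \<open>v\<close> adds \<open>card S\<close> times \<open>v\<close> to the
  coordinate sums, so these sums recover \<open>v\<close>.\<close>

lemma translate_eq_imp_eq:
  fixes s t :: square
  assumes fin: "finite S" and ne: "S \<noteq> {}" and eq: "(+) s ` S = (+) t ` S"
  shows "s = t"
proof -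
  have sum: "sum f ((+) v ` S) = int (card S) * f v + sum f S"
    if "\<And>a b. f (a + b) = f a + f b" for f :: "square \<Rightarrow> int" and v
    by (simp add: sum.reindex that sum.distrib)
  have "card S \<noteq> 0" using fin ne by simp
  moreover have "int (card S) * fst s = int (card S) * fst t" "int (card S) * snd s = int (card S) * snd t"
    using sum[of fst s] sum[of fst t] sum[of snd s] sum[of snd t] eq by auto
  ultimately show ?thesis by (simp add: prod_eq_iff)
qed

section \<open>The count of all translates, and the decomposition of the board\<close>

theorem theorem2:
  fixes p q k :: nat and e :: "op_type list" and P Q :: "nat \<Rightarrow> nat"
    and \<G> :: "square ugraph"
  assumes "p < q" and "skew p q" and "basic p q"
    and "is_descent e p q"
    and "k = length (gh_suffixes e) + 1"
    and "\<And>i. i \<in> {1..<k} \<Longrightarrow> is_descent (gh_suffixes e ! (i - 1)) (P i) (Q i)"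
    and "P k = 0" and "Q k = 1"
    and "\<G> = leaper_graph p q (square_board (p + q))"
  shows "card {v. isolated \<G> v} = (q - p)\<^sup>2
    \<and> verts \<G> = {v. isolated \<G> v} \<union> (\<Union>C\<in>cycles_of \<G>. verts C)
    \<and> edges \<G> = (\<Union>C\<in>cycles_of \<G>. edges C)
    \<and> pairwise (\<lambda>C D. disjnt (verts C) (verts D)) (cycles_of \<G>)
    \<and> (\<exists>T :: nat \<Rightarrow> square ugraph set.
          cycles_of \<G> = (\<Union>i\<in>{1..k}. T i)
        \<and> disjoint_family_on T {1..k}
        \<and> (\<forall>i\<in>{1..k}. card (T i) = (Q i - P i)\<^sup>2
            \<and> (\<forall>C\<in>T i. \<forall>D\<in>T i. \<exists>v. D = translate v C)
            \<and> (\<forall>C\<in>T i. toured_by (P i) (Q i) C)))"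
proof -
  let ?adj = "leap (int p) (int q)" and ?V = "square_board (p + q)"
  have p0: "0 < p" using is_descent_basic[OF assms(4)] by blast
  have graph: "\<G> = induced ?adj ?V" using assms(9) by (simp add: leaper_graph_induced)
  obtain ys where fam: "family p q (touring e) ys" using ex_family[OF assms(4)] by blast
  have len: "length ys = k"
    using fam assms(5) unfolding family_def touring_def by (metis length_append_singleton length_map Suc_eq_plus1)
  \<comment> \<open>List positions start at 0 and types at 1; the entry for type \<open>k\<close> is
    the pair \<open>(0, 1)\<close> at the end of \<open>touring e\<close>.\<close>
  have PQ: "fst (ys ! (i - 1)) = (P i, Q i) \<and> odd (P i + Q i)" if i: "i \<in> {1..k}" for i
  proof -
    have lt: "i - 1 < length ys" using i len by auto
    then have "fst (ys ! (i - 1)) = touring e ! (i - 1)"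
      using fam by (metis family_def nth_map)
    moreover have "touring e ! (i - 1) = (P i, Q i) \<and> odd (P i + Q i)"
    proof (cases "i = k")
      case True
      then show ?thesis using assms(5,7,8) by (simp add: touring_def nth_append)
    next
      case False
      then have "i \<in> {1..<k}" using i by auto
      from assms(6)[OF this] show ?thesis
        using \<open>i \<in> {1..<k}\<close> assms(5) is_descent_basic[OF assms(6)[OF \<open>i \<in> {1..<k}\<close>]]
        by (auto simp: touring_def nth_append is_descent_def basic_def)
    qed
    ultimately show ?thesis by simp
  qed
  define S where "S = (\<lambda>i. fst (snd (ys ! (i - 1))))"
  define c where "c = (\<lambda>i. fst (snd (snd (ys ! (i - 1)))))"
  define s where "s = (\<lambda>i. snd (snd (snd (ys ! (i - 1)))))"
  define d where "d = (\<lambda>i. int (Q i) - int (P i))"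
  \<comment> \<open>The coordinates of the shape are bounded in absolute value by half of
    \<open>p + q - d i\<close>. Its centre may thus take \<open>d i\<close> values in each
    coordinate, starting from \<open>off i\<close>.\<close>
  define off where "off = (\<lambda>i. (int p + int q - d i) div 2)"
  define Off where "Off = (\<lambda>i. {off i..<off i + d i} \<times> {off i..<off i + d i})"
  define \<K> where "\<K> = (\<Union>i\<in>{1..k}. (\<lambda>v. (+) v ` S i) ` Off i)"
  have entry: "ys ! (i - 1) = ((P i, Q i), S i, c i, s i)" if "i \<in> {1..k}" for i
    using PQ[OF that] by (simp add: S_def c_def s_def prod_eq_iff)
  have tours: "\<exists>gs ts. tour (int p) (int q) (d i) (S i) (int (P i)) (int (Q i)) gs ts \<and>
      length gs = c i \<and> length ts = s i" if "i \<in> {1..k}" for i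
  proof -
    have "ys ! (i - 1) \<in> set ys" using that len by auto
    then have "tourable (int p) (int q) (ys ! (i - 1))" using fam unfolding family_def by blast
    then show ?thesis using entry[OF that] by (simp add: d_def)
  qed
  have shape: "proper_shape (int p) (int q) (d i) (S i)" and finS: "finite (S i)"
    and card_S: "card (S i) = 4 * (c i + s i)"
    if i: "i \<in> {1..k}" for i
  proof -
    obtain gs ts where t: "tour (int p) (int q) (d i) (S i) (int (P i)) (int (Q i)) gs ts"
      and "length gs = c i" "length ts = s i" using tours[OF i] by blast
    then show "proper_shape (int p) (int q) (d i) (S i)" "finite (S i)" "card (S i) = 4 * (c i + s i)"
      using tour.axioms(1)[OF t] tour.finite_S[OF t] tour.card_S[OF t] by auto
  qed
  have ham: "toured_by (P i) (Q i) (induced ?adj ((+) v ` S i))" if i: "i \<in> {1..k}" for i v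
  proof -
    obtain gs ts where t: "tour (int p) (int q) (d i) (S i) (int (P i)) (int (Q i)) gs ts"
      using tours[OF i] by blast
    show ?thesis
      using tour.hamiltonian_translate[OF t, of v]
      by (simp add: toured_by_def leaper_graph_induced) (simp add: induced_def)
  qed
  have d: "0 < d i" if "i \<in> {1..k}" for i
    using shape[OF that] by (simp add: proper_shape_def shape_def)
  have off: "2 * off i = int p + int q - d i" if "i \<in> {1..k}" for i
  proof -
    \<comment> \<open>The division in \<open>off\<close> is exact, as both \<open>p + q\<close> and
      \<open>d i\<close> are odd.\<close>
    have "odd (int p + int q)" using assms(3) by (simp add: basic_def flip: of_nat_add)
    moreover have "odd (d i)" using PQ[OF that] by (simp add: d_def flip: of_nat_add)
    ultimately show ?thesis by (simp add: off_def)
  qed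
  have ne: "S i \<noteq> {}" if "i \<in> {1..k}" for i
    using shape[OF that] by (simp add: proper_shape_def shape_def)
  have smaller: "c i + s i < c j + s j" if "i \<in> {1..k}" "j \<in> {1..k}" "i < j" for i j
  proof -
    have "smaller (ys ! (i - 1)) (ys ! (j - 1))"
      using fam that len by (auto simp: family_def intro!: sorted_wrt_nth_less[of smaller ys])
    then show ?thesis using entry that by simp
  qed
  have inj: "i = j \<and> v = w"
    if "i \<in> {1..k}" "j \<in> {1..k}" "(+) v ` S i = (+) w ` S j" for i j v w
  proof -
    \<comment> \<open>Shapes of different types have different numbers of squares, which excludes
      coincidences between types.\<close>
    have "card (S i) = card (S j)"
      using arg_cong[OF that(3), of card] by (simp add: card_image)
    then have "i = j" using smaller[of i j] smaller[of j i] card_S that(1,2)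
      by (cases i j rule: linorder_cases) auto
    then show ?thesis using translate_eq_imp_eq[OF finS ne] that by blast
  qed
  interpret cycle_family ?adj ?V \<K>
  proof
    show "finite ?V" by (simp add: square_board_def)
    show "symp ?adj" by (rule symp_leap)
    show "\<not> ?adj v v" for v using p0 assms(1) by (simp add: leap_def)
    show "card {w \<in> ?V. ?adj v w} \<le> 2" if "v \<in> ?V" for v using board_degree[OF assms(1) that] .
    fix K assume "K \<in> \<K>"
    then obtain i v where i: "i \<in> {1..k}" and v: "v \<in> Off i" and K: "K = (+) v ` S i"
      by (auto simp: \<K>_def)
    interpret Si: proper_shape "int p" "int q" "d i" "S i" by (rule shape[OF i])
    show "K \<noteq> {}" using ne[OF i] K by simp
    show "connected_in ?adj K" unfolding K by (rule connected_in_translate[OF Si.con])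
    show "2 \<le> card {w \<in> K. ?adj z w}" if "z \<in> K" for z
      using that Si.degree_ge_2[OF _ finS[OF i]] p0 by (auto simp: K degree_translate)
    show "K \<subseteq> ?V"
    proof
      fix z assume "z \<in> K"
      then obtain x y where xy: "(x, y) \<in> S i" "z = v + (x, y)" using K by auto
      obtain a b where ab: "v = (a, b)" by (cases v)
      show "z \<in> ?V"
        using Si.zone1[OF xy(1)] Si.zone2[OF xy(1)] off[OF i] v
        by (auto simp: xy(2) ab Off_def mem_square_board)
    qed
  qed
  have nbr: "\<exists>w\<in>K. ?adj z w" if "K \<in> \<K>" "z \<in> K" for K z
  proof (rule ccontr)
    assume "\<not> (\<exists>w\<in>K. ?adj z w)"
    then have none: "{w \<in> K. ?adj z w} = {}" by blast
    show False using deg2[OF that] unfolding none by simp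
  qed
  have card_Off: "card (Off i) = (Q i - P i)\<^sup>2" if "i \<in> {1..k}" for i
    using d[OF that] by (simp add: Off_def d_def card_cartesian_product power2_eq_square nat_diff_distrib)
  let ?C = "{int p..<int q} \<times> {int p..<int q}"
  \<comment> \<open>The squares of the central block have no neighbours, which gives one inclusion.
    Equality follows as both sides have \<open>4 * p * q\<close> elements, the translates being
    disjoint.\<close>
  have cov: "\<Union>\<K> = ?V - ?C"
  proof (rule card_subset_eq)
    show "finite (?V - ?C)" using fin by simp
    show "\<Union>\<K> \<subseteq> ?V - ?C"
    proof
      fix z assume "z \<in> \<Union>\<K>"
      then obtain K where K: "K \<in> \<K>" "z \<in> K" by blast
      then obtain w where "w \<in> K" "?adj z w" using nbr by blast
      then show "z \<in> ?V - ?C" using board_center_isolated K sub[OF K(1)] by blast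
    qed
    have "card (?V - ?C) = card ?V - card ?C"
      by (rule card_Diff_subset) (use assms(1) in \<open>auto simp: mem_square_board\<close>)
    also have "card ?V = (p + q)\<^sup>2"
      by (simp add: square_board_def card_cartesian_product power2_eq_square nat_add_distrib)
    also have "card ?C = (q - p)\<^sup>2"
      using assms(1) by (simp add: card_cartesian_product power2_eq_square nat_diff_distrib)
    finally have "card (?V - ?C) = (p + q)\<^sup>2 - (q - p)\<^sup>2" .
    moreover have "(q - p)\<^sup>2 \<le> (p + q)\<^sup>2" by (rule power_mono) auto
    ultimately have "int (card (?V - ?C)) = (int (p + q))\<^sup>2 - (int (q - p))\<^sup>2"
      by (simp only: of_nat_diff of_nat_power)
    also have "\<dots> = (int p + int q)\<^sup>2 - (int q - int p)\<^sup>2"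
      using assms(1) by (simp add: of_nat_diff)
    finally have rhs: "int (card (?V - ?C)) = 4 * int p * int q"
      by (simp add: power2_eq_square algebra_simps)
    have sum_entries: "(\<Sum>i\<in>{1..k}. f (ys ! (i - 1))) = sum_list (map f ys)" for f :: "entry \<Rightarrow> int"
    proof -
      have "(\<Sum>i\<in>{1..k}. f (ys ! (i - 1))) = (\<Sum>i<k. f (ys ! i))"
        by (rule sum.reindex_bij_witness[of _ Suc "\<lambda>i. i - 1"]) auto
      then show ?thesis by (simp add: sum_list_sum_nth len atLeast0LessThan)
    qed
    let ?I = "Sigma {1..k} Off"
    have finOff: "finite (Off i)" for i by (simp add: Off_def)
    have "\<Union>\<K> = (\<Union>x\<in>?I. (+) (snd x) ` S (fst x))" by (force simp: \<K>_def)
    also have "card \<dots> = (\<Sum>x\<in>?I. card ((+) (snd x) ` S (fst x)))"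
    proof (rule card_UN_disjoint)
      show "\<forall>x\<in>?I. \<forall>y\<in>?I. x \<noteq> y \<longrightarrow> (+) (snd x) ` S (fst x) \<inter> (+) (snd y) ` S (fst y) = {}"
      proof (intro ballI impI)
        fix x y assume xy: "x \<in> ?I" "y \<in> ?I" "x \<noteq> y"
        then obtain i v j w where x: "x = (i, v)" "i \<in> {1..k}" "v \<in> Off i"
          and y: "y = (j, w)" "j \<in> {1..k}" "w \<in> Off j" by (elim SigmaE)
        have K: "(+) (snd x) ` S (fst x) \<in> \<K>" "(+) (snd y) ` S (fst y) \<in> \<K>"
          unfolding x(1) y(1) \<K>_def fst_conv snd_conv using x(2,3) y(2,3) by blast+
        have "(+) (snd x) ` S (fst x) \<noteq> (+) (snd y) ` S (fst y)"
          unfolding x(1) y(1) fst_conv snd_conv using inj[OF x(2) y(2), of v w] xy(3) x(1) y(1) by blast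
        then show "(+) (snd x) ` S (fst x) \<inter> (+) (snd y) ` S (fst y) = {}"
          using disjoint[OF K] by blast
      qed
    qed (use finOff finS in auto)
    also have "\<dots> = (\<Sum>x\<in>?I. card (S (fst x)))" by (simp add: card_image)
    also have "\<dots> = (\<Sum>i\<in>{1..k}. \<Sum>v\<in>Off i. card (S i))"
      using finOff by (subst sum.Sigma) (auto simp: case_prod_unfold)
    also have "int \<dots> = (\<Sum>i\<in>{1..k}. 4 * (corners (ys ! (i - 1)) + sides (ys ! (i - 1))))"
    proof -
      have "int (card (Off i) * card (S i)) = 4 * (corners (ys ! (i - 1)) + sides (ys ! (i - 1)))"
        if "i \<in> {1..k}" for i
        using d[OF that] unfolding card_Off[OF that] card_S[OF that] entry[OF that]
        by (simp add: d_def of_nat_diff algebra_simps)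
      then show ?thesis by simp
    qed
    also have "\<dots> = 4 * (\<Sum>i\<in>{1..k}. corners (ys ! (i - 1))) + 4 * (\<Sum>i\<in>{1..k}. sides (ys ! (i - 1)))"
      by (simp add: sum.distrib sum_distrib_left)
    \<comment> \<open>The totals in \<open>family\<close> account for the four corner blocks and the
      four side blocks of the border.\<close>
    also have "\<dots> = 4 * int p * int q"
      unfolding sum_entries using fam by (simp add: family_def power2_eq_square algebra_simps)
    finally show "card (\<Union>\<K>) = card (?V - ?C)" using rhs by simp
  qed
  have nonisolated: "{v \<in> ?V. \<exists>w\<in>?V. ?adj v w} \<subseteq> \<Union>\<K>"
    unfolding cov using board_center_isolated by blast
  have cycles: "cycles_of \<G> = induced ?adj ` \<K>" unfolding graph by (rule cycles_of_induced[OF nonisolated])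
  have verts: "verts (induced ?adj B) = B" for B by (simp add: induced_def)
  have iso: "{v. isolated \<G> v} = ?C"
  proof
    show "?C \<subseteq> {v. isolated \<G> v}"
      using board_center_isolated assms(1)
      by (auto simp: graph isolated_induced[OF symp_leap] mem_square_board)
    show "{v. isolated \<G> v} \<subseteq> ?C"
    proof
      fix z assume "z \<in> {v. isolated \<G> v}"
      then have z: "z \<in> ?V" "\<And>w. w \<in> ?V \<Longrightarrow> \<not> ?adj z w"
        by (auto simp: graph isolated_induced[OF symp_leap])
      show "z \<in> ?C"
      proof (rule ccontr)
        assume "z \<notin> ?C"
        then obtain K where K: "K \<in> \<K>" "z \<in> K" using z(1) cov by blast
        then obtain w where "w \<in> K" "?adj z w" using nbr by blast
        then show False using z(2) sub[OF K(1)] by blast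
      qed
    qed
  qed
  define T where "T = (\<lambda>i. (\<lambda>v. induced ?adj ((+) v ` S i)) ` Off i)"
  have inj_T: "i = j \<and> v = w"
    if "i \<in> {1..k}" "j \<in> {1..k}" "induced ?adj ((+) v ` S i) = induced ?adj ((+) w ` S j)" for i j v w
    using inj[OF that(1,2)] arg_cong[OF that(3), of verts] by (simp add: verts)
  show ?thesis
  proof (intro conjI exI[of _ T] ballI)
    show "card {v. isolated \<G> v} = (q - p)\<^sup>2"
      using assms(1) by (simp add: iso card_cartesian_product power2_eq_square nat_diff_distrib)
    have "?V = ?C \<union> \<Union>\<K>" using cov assms(1) by (auto simp: mem_square_board)
    then show "verts \<G> = {v. isolated \<G> v} \<union> (\<Union>C\<in>cycles_of \<G>. verts C)"
      unfolding iso cycles by (simp add: graph verts)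
    show "edges \<G> = (\<Union>C\<in>cycles_of \<G>. edges C)"
    proof
      show "edges \<G> \<subseteq> (\<Union>C\<in>cycles_of \<G>. edges C)"
      proof
        fix f assume "f \<in> edges \<G>"
        then obtain a b where ab: "f = {a, b}" "a \<in> ?V" "b \<in> ?V" "?adj a b"
          by (auto simp: graph induced_def)
        then obtain K where K: "K \<in> \<K>" "a \<in> K" using nonisolated by blast
        then have "b \<in> K" using closedD ab by blast
        then have "f \<in> edges (induced ?adj K)" using ab K unfolding induced_def ugraph.sel by blast
        then show "f \<in> (\<Union>C\<in>cycles_of \<G>. edges C)" using K unfolding cycles by blast
      qed
      show "(\<Union>C\<in>cycles_of \<G>. edges C) \<subseteq> edges \<G>"
        by (auto simp: cycles_of_def subgraph_of_def)
    qed
    show "pairwise (\<lambda>C D. disjnt (verts C) (verts D)) (cycles_of \<G>)"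
      unfolding cycles pairwise_def disjnt_def using disjoint by (auto simp: verts)
    show "cycles_of \<G> = (\<Union>i\<in>{1..k}. T i)"
      unfolding cycles \<K>_def T_def by (simp add: image_UN image_image)
    show "disjoint_family_on T {1..k}"
      unfolding disjoint_family_on_def T_def using inj_T by fast
  next
    fix i assume i: "i \<in> {1..k}"
    have "inj_on (\<lambda>v. induced ?adj ((+) v ` S i)) (Off i)"
      using inj_T[OF i i] by (auto simp: inj_on_def)
    then show "card (T i) = (Q i - P i)\<^sup>2"
      unfolding T_def by (simp add: card_image card_Off[OF i])
    fix C assume C: "C \<in> T i"
    then obtain v where v: "C = induced ?adj ((+) v ` S i)" by (auto simp: T_def)
    show "toured_by (P i) (Q i) C" unfolding v by (rule ham[OF i])
    fix D assume D: "D \<in> T i"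
    then obtain w where w: "D = induced ?adj ((+) w ` S i)" by (auto simp: T_def)
    have "D = translate (w - v) C" unfolding v w translate_induced by (simp add: image_image add.assoc[symmetric])
    then show "\<exists>u. D = translate u C" ..
  qed
qed

end
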